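(* Let $X$ be a CW-complex whose cells are indexed by a set $A$, let $J$ be a set, and let $R\subseteq A\times J$ be a relation that is downwardly closed, meaning that $(\alpha,j)\in R$ and $\alpha'\le\alpha$ imply $(\alpha',j)\in R$ for all $\alpha,\alpha'\in A$ and $j\in J$. Then the map $$X\times_R|\Delta J| \longrightarrow X_R$$ obtained by restricting the projection $X\times|\Delta J|\to X$ is a homotopy equivalence.
   Context: $X$ has open cells $e_\alpha$ ($\alpha\in A$) with closures $\overline{e}_\alpha$. The partial order on $A$ is the smallest transitive relation that includes $\alpha\ge\alpha'$ whenever $\overline{e}_\alpha\cap e_{\alpha'}\neq\emptyset$. Down-sets of $A$ correspond to subcomplexes of $X$ (unions of the corresponding cells). $\Delta J$ is the set of non-empty finite subsets of $J$ ordered by inclusion, viewed as the complete simplicial complex on $J$; $|\Delta J|$ is its geometric realization (a CW-complex), and $|\tau|\subseteq|\Delta J|$ is the closed geometric simplex of $\tau\in\Delta J$. The product $X\times|\Delta J|$ is the product CW-complex, i.e. it carries the compactly generated product topology. Define the subcomplex $X_R = \bigcup\{\overline{e}_\alpha \mid \text{there exists } j\in J \text{ with } (\alpha,j)\in R\}$ of $X$. Define $R_J = \{(\alpha,\tau)\in A\times\Delta J \mid \{\alpha\}\times\tau\subseteq R\}$, a down-set of $A\times\Delta J$, and the subcomplex $$X\times_R|\Delta J| = \bigcup\{\overline{e}_\alpha\times|\tau| \mid (\alpha,\tau)\in R_J\}$$ of $X\times|\Delta J|$. The projection $X\times|\Delta J|\to X$ maps $X\times_R|\Delta J|$ into $X_R$.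 *)

theory Defs
  imports "HOL-Analysis.Analysis"
begin

section \<open>Homotopy equivalences\<close>

definition homotopy_equivalence_map :: "'a topology \<Rightarrow> 'b topology \<Rightarrow> ('a \<Rightarrow> 'b) \<Rightarrow> bool" where
  "homotopy_equivalence_map X Y f \<longleftrightarrow>
     continuous_map X Y f \<and>
     (\<exists>g. continuous_map Y X g \<and>
          homotopic_with (\<lambda>_. True) X X (g \<circ> f) id \<and>
          homotopic_with (\<lambda>_. True) Y Y (f \<circ> g) id)"

lemma homotopy_equivalent_space_iff_map:
  "X homotopy_equivalent_space Y \<longleftrightarrow> (\<exists>f. homotopy_equivalence_map X Y f)"
  unfolding homotopy_equivalent_space_def homotopy_equivalence_map_def by blast


section \<open>Coherent topologies and compactly generated products\<close>

definition coherent_topology :: "'a topology set \<Rightarrow> 'a topology" where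
  "coherent_topology \<T> =
     topology (\<lambda>U. U \<subseteq> (\<Union>T\<in>\<T>. topspace T) \<and> (\<forall>T\<in>\<T>. openin T (U \<inter> topspace T)))"

lemma openin_coherent_topology:
  "openin (coherent_topology \<T>) U \<longleftrightarrow>
     U \<subseteq> (\<Union>T\<in>\<T>. topspace T) \<and> (\<forall>T\<in>\<T>. openin T (U \<inter> topspace T))"
proof -
  have "istopology (\<lambda>U. U \<subseteq> (\<Union>T\<in>\<T>. topspace T) \<and> (\<forall>T\<in>\<T>. openin T (U \<inter> topspace T)))"
    (is "istopology ?P")
    unfolding istopology_def
  proof (intro conjI allI impI)
    fix S V assume S: "?P S" and V: "?P V"
    then show "S \<inter> V \<subseteq> (\<Union>T\<in>\<T>. topspace T)" by blast
    show "\<forall>T\<in>\<T>. openin T (S \<inter> V \<inter> topspace T)"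
    proof
      fix T assume "T \<in> \<T>"
      then have "openin T (S \<inter> topspace T)" "openin T (V \<inter> topspace T)"
        using S V by blast+
      then have "openin T ((S \<inter> topspace T) \<inter> (V \<inter> topspace T))"
        by (rule openin_Int)
      moreover have "(S \<inter> topspace T) \<inter> (V \<inter> topspace T) = S \<inter> V \<inter> topspace T"
        by blast
      ultimately show "openin T (S \<inter> V \<inter> topspace T)"
        by (simp only:)
    qed
  next
    fix K assume K: "\<forall>U\<in>K. ?P U"
    then show "\<Union> K \<subseteq> (\<Union>T\<in>\<T>. topspace T)" by blast
    show "\<forall>T\<in>\<T>. openin T (\<Union> K \<inter> topspace T)"
    proof
      fix T assume "T \<in> \<T>"
      then have "openin T V" if "V \<in> (\<lambda>U. U \<inter> topspace T) ` K" for V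
        using K that by blast
      then have "openin T (\<Union>U\<in>K. U \<inter> topspace T)"
        by (rule openin_Union)
      moreover have "(\<Union>U\<in>K. U \<inter> topspace T) = \<Union> K \<inter> topspace T"
        by blast
      ultimately show "openin T (\<Union> K \<inter> topspace T)"
        by (simp only:)
    qed
  qed
  then show ?thesis
    unfolding coherent_topology_def by (simp only: topology_inverse')
qed

lemma topspace_coherent_topology [simp]:
  "topspace (coherent_topology \<T>) = (\<Union>T\<in>\<T>. topspace T)"
proof -
  have "(\<Union>T\<in>\<T>. topspace T) \<inter> topspace T = topspace T" if "T \<in> \<T>" for T
    using that by blast
  then have "openin (coherent_topology \<T>) (\<Union>T\<in>\<T>. topspace T)"
    by (simp add: openin_coherent_topology)
  then show ?thesis
    by (meson openin_coherent_topology openin_subset openin_topspace subset_antisym)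
qed

definition compactly_generated_prod :: "'a topology \<Rightarrow> 'b topology \<Rightarrow> ('a \<times> 'b) topology" where
  "compactly_generated_prod X Y = kification (prod_topology X Y)"


section \<open>CW-complexes\<close>

definition closed_disk :: "nat \<Rightarrow> (nat \<Rightarrow> real) set" where
  "closed_disk n = {x \<in> topspace (Euclidean_space n). (\<Sum>i<n. (x i)\<^sup>2) \<le> 1}"

definition open_disk :: "nat \<Rightarrow> (nat \<Rightarrow> real) set" where
  "open_disk n = {x \<in> topspace (Euclidean_space n). (\<Sum>i<n. (x i)\<^sup>2) < 1}"

text \<open>
  Whitehead's definition, for a space \<open>X\<close> with open cells \<open>e \<alpha>\<close> indexed by \<open>\<alpha> \<in> A\<close>. Here
  \<open>d \<alpha>\<close> is the dimension of \<open>e \<alpha>\<close> and \<open>\<Phi> \<alpha>\<close> is a characteristic map; neither is part of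
  the structure. No condition on the cardinality of \<open>A\<close> or on the dimensions is imposed.
\<close>
definition cw_complex :: "'x topology \<Rightarrow> 'a set \<Rightarrow> ('a \<Rightarrow> 'x set) \<Rightarrow> bool" where
  "cw_complex X A e \<longleftrightarrow>
     Hausdorff_space X \<and>
     topspace X = (\<Union>\<alpha>\<in>A. e \<alpha>) \<and>
     disjoint_family_on e A \<and>
     (\<exists>d \<Phi>. \<forall>\<alpha>\<in>A.
        continuous_map (subtopology (Euclidean_space (d \<alpha>)) (closed_disk (d \<alpha>))) X (\<Phi> \<alpha>) \<and>
        homeomorphic_map (subtopology (Euclidean_space (d \<alpha>)) (open_disk (d \<alpha>)))
          (subtopology X (e \<alpha>)) (\<Phi> \<alpha>) \<and>
        (\<exists>B. finite B \<and> B \<subseteq> A \<and> (\<forall>\<beta>\<in>B. d \<beta> < d \<alpha>) \<and>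
             \<Phi> \<alpha> ` (closed_disk (d \<alpha>) - open_disk (d \<alpha>)) \<subseteq> (\<Union>\<beta>\<in>B. e \<beta>))) \<and>
     (\<forall>C \<subseteq> topspace X.
        (\<forall>\<alpha>\<in>A. closedin X (C \<inter> X closure_of e \<alpha>)) \<longrightarrow> closedin X C)"

text \<open>\<open>(\<alpha>', \<alpha>) \<in> cell_order X A e\<close> means \<open>\<alpha>' \<le> \<alpha>\<close>.\<close>
definition cell_order :: "'x topology \<Rightarrow> 'a set \<Rightarrow> ('a \<Rightarrow> 'x set) \<Rightarrow> ('a \<times> 'a) set" where
  "cell_order X A e =
     {(\<alpha>', \<alpha>). \<alpha>' \<in> A \<and> \<alpha> \<in> A \<and> X closure_of e \<alpha> \<inter> e \<alpha>' \<noteq> {}}\<^sup>+"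


section \<open>The complete simplicial complex and its realization\<close>

definition finite_simplices :: "'j set \<Rightarrow> 'j set set" where
  "finite_simplices J = {\<tau>. \<tau> \<subseteq> J \<and> finite \<tau> \<and> \<tau> \<noteq> {}}"

text \<open>Points of the realization are given by barycentric coordinates.\<close>
definition geometric_simplex :: "'j set \<Rightarrow> ('j \<Rightarrow> real) set" where
  "geometric_simplex \<tau> = {t. (\<forall>j. 0 \<le> t j) \<and> (\<forall>j. j \<notin> \<tau> \<longrightarrow> t j = 0) \<and> (\<Sum>j\<in>\<tau>. t j) = 1}"

text \<open>
  On each finite simplex the topology below is the Euclidean one; the realization carries
  the CW (coherent) topology and not the subspace topology of the product.
\<close>
definition realization :: "'j set \<Rightarrow> ('j \<Rightarrow> real) topology" where
  "realization J =
     coherent_topology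
       ((\<lambda>\<tau>. subtopology (powertop_real UNIV) (geometric_simplex \<tau>)) ` finite_simplices J)"

lemma topspace_realization:
  "topspace (realization J) = (\<Union>\<tau>\<in>finite_simplices J. geometric_simplex \<tau>)"
  by (simp add: realization_def)


section \<open>The spaces associated with a relation\<close>

definition rel_domain_complex ::
  "'x topology \<Rightarrow> ('a \<Rightarrow> 'x set) \<Rightarrow> ('a \<times> 'j) set \<Rightarrow> 'x topology" where
  "rel_domain_complex X e R =
     subtopology X (\<Union>{X closure_of e \<alpha> | \<alpha>. \<exists>j. (\<alpha>, j) \<in> R})"

definition rel_simplices ::
  "'a set \<Rightarrow> 'j set \<Rightarrow> ('a \<times> 'j) set \<Rightarrow> ('a \<times> 'j set) set" where
  "rel_simplices A J R = {(\<alpha>, \<tau>). \<alpha> \<in> A \<and> \<tau> \<in> finite_simplices J \<and> {\<alpha>} \<times> \<tau> \<subseteq> R}"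

definition rel_product_complex ::
  "'x topology \<Rightarrow> 'a set \<Rightarrow> ('a \<Rightarrow> 'x set) \<Rightarrow> 'j set \<Rightarrow> ('a \<times> 'j) set
     \<Rightarrow> ('x \<times> ('j \<Rightarrow> real)) topology" where
  "rel_product_complex X A e J R =
     subtopology (compactly_generated_prod X (realization J))
       (\<Union>{(X closure_of e \<alpha>) \<times> geometric_simplex \<tau> | \<alpha> \<tau>. (\<alpha>, \<tau>) \<in> rel_simplices A J R})"

end

theory Submission
  imports Defs
begin

text \<open>
  Write \<open>cell x\<close> for the index of the open cell that contains \<open>x\<close>. As \<open>R\<close> is downwardly closed,
  \<open>X \<times>\<^sub>R |\<Delta>J|\<close> consists of the pairs \<open>(x, t)\<close> such that every \<open>j\<close> in the support of \<open>t\<close> satisfies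
  \<open>(cell x, j) \<in> R\<close>. So the fibre of the projection over \<open>x\<close> is \<open>|\<Delta>J\<^sub>x|\<close>
  for \<open>J\<^sub>x = {j. (cell x, j) \<in> R}\<close>, which is convex and, for \<open>x \<in> X\<^sub>R\<close>, non-empty.

  In general there is no continuous section. Towards the boundary of a cell \<open>J\<^sub>x\<close> can only grow; at a
  vertex where two edges \<open>\<alpha>\<close>, \<open>\<beta>\<close> meet, a section would need a value supported both in
  \<open>J\<^sub>\<alpha>\<close> and in \<open>J\<^sub>\<beta>\<close>, and these sets may be disjoint. There is a section up to homotopy, however. It is
  built from two maps:

  \<^item> a homotopy \<open>push s\<close> from the identity of \<open>X\<close> that moves every point only into cells below its
  own, and whose end \<open>push 1\<close> stretches the middle of each cell over the whole cell and
  collapses a collar into the boundary;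

  \<^item> a map \<open>weight\<close> into \<open>|\<Delta>J|\<close> that has in the middle of a cell \<open>\<alpha>\<close> the vertex \<open>pick \<alpha>\<close>, where
  \<open>(\<alpha>, pick \<alpha>) \<in> R\<close> if \<open>\<alpha>\<close> occurs in \<open>R\<close>, and which interpolates linearly, in the outer
  part of the collar, where \<open>push 1\<close> is constant along radii, between this vertex and the value
  on the boundary.

  Both are defined by recursion on the dimension of the cell. By construction every \<open>j\<close> in the
  support of \<open>weight x\<close> is \<open>pick \<beta>\<close> for a cell \<open>\<beta>\<close> with \<open>cell (push 1 x) \<le> \<beta> \<le> cell x\<close> (lemma \<open>weight_support\<close>), so
  \<open>x \<mapsto> (push 1 x, weight x)\<close> maps \<open>X\<^sub>R\<close> into \<open>X \<times>\<^sub>R |\<Delta>J|\<close>. It is a homotopy inverse of the projection: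
  the composite on \<open>X\<^sub>R\<close> is \<open>push 1\<close>, and the composite on \<open>X \<times>\<^sub>R |\<Delta>J|\<close> is reached from the identity by
  the homotopy \<open>(push s x, t)\<close> followed by the straight line from \<open>(push 1 x, t)\<close> to
  \<open>(push 1 x, weight x)\<close>, which stays in one simplex because the supports of \<open>t\<close> and of \<open>weight x\<close>
  both lie in \<open>J\<^sub>y\<close> for \<open>y = push 1 x\<close>.

  Continuity is checked on compact sets, as \<open>X\<close>, the k-ified product and their products with
  \<open>[0,1]\<close> are k-spaces. A compact subset of \<open>X\<close> lies in finitely many closed cells and one of
  \<open>|\<Delta>J|\<close> in a single simplex (lemma \<open>finite_labels_of_compact\<close>), and a map on a finite union of
  closed cells is continuous if its composites with the characteristic maps are.
\<close>

section \<open>Disks\<close>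

definition radial_norm :: "nat \<Rightarrow> (nat \<Rightarrow> real) \<Rightarrow> real" where
  "radial_norm n v = sqrt (\<Sum>i<n. (v i)\<^sup>2)"

definition scale_vec :: "real \<Rightarrow> (nat \<Rightarrow> real) \<Rightarrow> (nat \<Rightarrow> real)" where
  "scale_vec c v = (\<lambda>i. c * v i)"

lemma radial_norm_nonneg: "0 \<le> radial_norm n v"
  by (simp add: radial_norm_def sum_nonneg)

lemma radial_norm_scale: "0 \<le> c \<Longrightarrow> radial_norm n (scale_vec c v) = c * radial_norm n v"
  by (simp add: radial_norm_def scale_vec_def power_mult_distrib real_sqrt_mult
      flip: sum_distrib_left)

lemma scale_vec_1 [simp]: "scale_vec 1 v = v"
  by (simp add: scale_vec_def)

lemma closed_disk_iff: "v \<in> closed_disk n \<longleftrightarrow> (\<forall>i\<ge>n. v i = 0) \<and> radial_norm n v \<le> 1"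
  by (simp add: closed_disk_def topspace_Euclidean_space radial_norm_def)

lemma open_disk_iff: "v \<in> open_disk n \<longleftrightarrow> (\<forall>i\<ge>n. v i = 0) \<and> radial_norm n v < 1"
  by (simp add: open_disk_def topspace_Euclidean_space radial_norm_def)

lemma open_disk_subset_closed_disk: "open_disk n \<subseteq> closed_disk n"
  by (auto simp: closed_disk_iff open_disk_iff)

lemma boundary_disk_iff:
  "v \<in> closed_disk n - open_disk n \<longleftrightarrow> (\<forall>i\<ge>n. v i = 0) \<and> radial_norm n v = 1"
  by (auto simp: closed_disk_iff open_disk_iff)

lemma scale_vec_in_closed_disk:
  assumes "v \<in> closed_disk n" "0 \<le> c" "c * radial_norm n v \<le> 1"
  shows "scale_vec c v \<in> closed_disk n"
  using assms by (simp add: closed_disk_iff radial_norm_scale) (simp add: scale_vec_def)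

lemma normalize_in_boundary_disk:
  assumes "v \<in> closed_disk n" "0 < radial_norm n v"
  shows "scale_vec (1 / radial_norm n v) v \<in> closed_disk n - open_disk n"
  using assms unfolding boundary_disk_iff
  by (simp add: closed_disk_iff radial_norm_scale) (simp add: scale_vec_def)

lemma continuous_on_radial_norm [continuous_intros]:
  assumes "continuous_on S f"
  shows "continuous_on S (\<lambda>x. radial_norm n (f x))"
proof -
  have "continuous_on S (\<lambda>x. f x i)" for i
    using assms by (rule continuous_on_product_then_coordinatewise)
  then show ?thesis
    unfolding radial_norm_def by (intro continuous_intros)
qed

lemma continuous_on_scale_vec [continuous_intros]:
  assumes "continuous_on S c" "continuous_on S f"
  shows "continuous_on S (\<lambda>x. scale_vec (c x) (f x))"
proof -
  have "continuous_on S (\<lambda>x. f x i)" for i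
    using assms(2) by (rule continuous_on_product_then_coordinatewise)
  then show ?thesis
    unfolding scale_vec_def continuous_on_coordinatewise_iff
    by (intro allI continuous_intros assms)
qed

lemma subtopology_powertop_real: "subtopology (powertop_real UNIV) S = top_of_set S"
  by (simp add: euclidean_product_topology)

text \<open>
  As the product topology on \<open>nat \<Rightarrow> real\<close> is the Euclidean topology of the type class, continuity on
disks becomes \<open>continuous_on\<close>.
\<close>
lemma subtopology_disk:
  assumes "S \<subseteq> closed_disk n"
  shows "subtopology (Euclidean_space n) S = top_of_set S"
proof -
  have "{x. \<forall>i\<ge>n. x i = 0} \<inter> S = S"
    using assms by (auto simp: closed_disk_iff)
  then show ?thesis
    by (simp add: Euclidean_space_def subtopology_subtopology subtopology_powertop_real)
qed

lemma closed_coordinate_zero: "closed {x :: 'i \<Rightarrow> real. \<forall>i\<in>I. x i = 0}"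
proof -
  have "{x :: 'i \<Rightarrow> real. \<forall>i\<in>I. x i = 0} = (\<Inter>i\<in>I. {x. x i = 0})"
    by auto
  moreover have "closed {x :: 'i \<Rightarrow> real. x i = 0}" for i
    by (intro closed_Collect_eq continuous_on_product_coordinates continuous_intros)
  ultimately show ?thesis
    by (simp add: closed_INT)
qed

text \<open>
  Tychonoff's theorem takes the place of the Heine-Borel theorem, since the vectors live in an
  infinite product of lines.
\<close>
lemma compact_cube: "compact {x :: 'i \<Rightarrow> real. \<forall>i. x i \<in> {-1..1}}"
proof -
  have "compactin (powertop_real UNIV) (PiE UNIV (\<lambda>i::'i. {-1..1::real}))"
    by (simp add: compactin_PiE)
  moreover have "PiE UNIV (\<lambda>i::'i. {-1..1::real}) = {x. \<forall>i. x i \<in> {-1..1}}"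
    by (auto simp: PiE_UNIV_domain)
  ultimately show ?thesis
    by (simp add: euclidean_product_topology)
qed

lemma compact_closed_disk: "compact (closed_disk n)"
proof -
  have bound: "x i \<in> {-1..1}" if "x \<in> closed_disk n" for x i
  proof (cases "i < n")
    case True
    then have "(x i)\<^sup>2 \<le> (\<Sum>i<n. (x i)\<^sup>2)"
      by (intro member_le_sum) auto
    also have "\<dots> \<le> 1"
      using that by (simp add: closed_disk_iff radial_norm_def)
    finally show ?thesis
      by (simp add: abs_square_le_1 abs_le_iff)
  next
    case False
    then show ?thesis
      using that by (simp add: closed_disk_iff)
  qed
  have "closed ({x. \<forall>i\<in>{n..}. x i = 0} \<inter> {x. radial_norm n x \<le> 1})"
    by (intro closed_Int closed_coordinate_zero closed_Collect_le continuous_intros)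
  moreover have "closed_disk n =
      {x. \<forall>i. x i \<in> {-1..1}} \<inter> ({x. \<forall>i\<in>{n..}. x i = 0} \<inter> {x. radial_norm n x \<le> 1})"
    using bound by (auto simp: closed_disk_iff)
  ultimately show ?thesis
    using compact_Int_closed[OF compact_cube] by simp
qed

section \<open>Compact sets in coherent spaces\<close>

text \<open>
  One argument serves for CW-complexes (labels: the open cell of a point) and for simplicial
  complexes (labels: the support of a point). Choose one point of \<open>K\<close> for each label. Every subset of
  the chosen points meets each piece \<open>C i\<close> in finitely many points and hence is closed; so the chosen
  points form a closed discrete subset of a compact set.
\<close>
lemma finite_labels_of_compact:
  assumes K: "compactin X K"
    and closed: "\<And>S. \<lbrakk>S \<subseteq> topspace X; \<And>i. i \<in> I \<Longrightarrow> finite (S \<inter> C i)\<rbrakk> \<Longrightarrow> closedin X S"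
    and fin: "\<And>i. i \<in> I \<Longrightarrow> finite (lab ` C i)"
  shows "finite (lab ` K)"
proof (rule ccontr)
  assume inf: "infinite (lab ` K)"
  obtain S where S: "S \<subseteq> K" "inj_on lab S" "lab ` K = lab ` S"
    by (metis subset_image_inj subset_refl)
  have "closedin X T" if "T \<subseteq> S" for T
  proof (rule closed)
    show "T \<subseteq> topspace X"
      using that S K compactin_subset_topspace by fastforce
    show "finite (T \<inter> C i)" if "i \<in> I" for i
    proof (rule finite_imageD)
      show "finite (lab ` (T \<inter> C i))"
        using fin[OF that] by (rule rev_finite_subset) auto
      show "inj_on lab (T \<inter> C i)"
        using S(2) \<open>T \<subseteq> S\<close> by (meson inf_le1 inj_on_subset)
    qed
  qed
  then have closed_S: "closedin X (S - {x})" for x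
    by simp
  have "infinite S"
    using inf S(3) by auto
  then obtain x where x: "x \<in> X derived_set_of S"
    using compactin_imp_Bolzano_Weierstrass[OF K] S(1) by blast
  then have "x \<in> topspace X"
    by (simp add: in_derived_set_of)
  then have "openin X (topspace X - (S - {x}))" "x \<in> topspace X - (S - {x})"
    using closed_S by (auto simp: closedin_def)
  then obtain y where "y \<noteq> x" "y \<in> S" "y \<in> topspace X - (S - {x})"
    using x unfolding in_derived_set_of by meson
  then show False
    by simp
qed

lemma closedin_coherent_topology:
  assumes "S \<subseteq> (\<Union>T\<in>\<T>. topspace T)" "\<And>T. T \<in> \<T> \<Longrightarrow> closedin T (S \<inter> topspace T)"
  shows "closedin (coherent_topology \<T>) S"
proof -
  have "openin T (((\<Union>T\<in>\<T>. topspace T) - S) \<inter> topspace T)" if "T \<in> \<T>" for T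
  proof -
    have "openin T (topspace T - S \<inter> topspace T)"
      using assms(2)[OF that] by blast
    moreover have "((\<Union>T\<in>\<T>. topspace T) - S) \<inter> topspace T = topspace T - S \<inter> topspace T"
      using that by blast
    ultimately show ?thesis
      by simp
  qed
  then show ?thesis
    using assms(1) by (auto simp: closedin_def openin_coherent_topology)
qed

section \<open>The realization of the complete simplicial complex\<close>

lemma geometric_simplex_mono:
  assumes "\<tau> \<subseteq> \<sigma>" "finite \<sigma>"
  shows "geometric_simplex \<tau> \<subseteq> geometric_simplex \<sigma>"
proof
  fix t assume t: "t \<in> geometric_simplex \<tau>"
  have "(\<Sum>j\<in>\<sigma>. t j) = (\<Sum>j\<in>\<tau>. t j)"
    using assms t by (intro sum.mono_neutral_right) (auto simp: geometric_simplex_def)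
  with t assms show "t \<in> geometric_simplex \<sigma>"
    by (auto simp: geometric_simplex_def)
qed

lemma geometric_simplex_convex:
  assumes "t \<in> geometric_simplex \<tau>" "u \<in> geometric_simplex \<tau>" "0 \<le> c" "c \<le> (1::real)"
  shows "(\<lambda>j. (1 - c) * t j + c * u j) \<in> geometric_simplex \<tau>"
  using assms by (auto simp: geometric_simplex_def sum.distrib simp flip: sum_distrib_left)

lemma vertex_in_geometric_simplex: "(\<lambda>j. of_bool (j = k)) \<in> geometric_simplex {k}"
  by (simp add: geometric_simplex_def)

lemma vertex_in_realization:
  "k \<in> J \<Longrightarrow> (\<lambda>j. of_bool (j = k)) \<in> topspace (realization J)"
  using vertex_in_geometric_simplex[of k]
  by (auto simp: topspace_realization finite_simplices_def)

lemma geometric_simplex_support: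
  assumes "t \<in> topspace (realization J)"
  shows "{j. t j \<noteq> 0} \<in> finite_simplices J" "t \<in> geometric_simplex {j. t j \<noteq> 0}"
proof -
  obtain \<tau> where \<tau>: "\<tau> \<subseteq> J" "finite \<tau>" and t: "t \<in> geometric_simplex \<tau>"
    using assms by (auto simp: topspace_realization finite_simplices_def)
  have sub: "{j. t j \<noteq> 0} \<subseteq> \<tau>"
    using t by (auto simp: geometric_simplex_def)
  then have "(\<Sum>j\<in>\<tau>. t j) = (\<Sum>j\<in>{j. t j \<noteq> 0}. t j)"
    using \<tau> by (intro sum.mono_neutral_right) auto
  then have sum1: "(\<Sum>j\<in>{j. t j \<noteq> 0}. t j) = 1"
    using t by (simp add: geometric_simplex_def)
  then have "{j. t j \<noteq> 0} \<noteq> {}"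
    by (metis sum.empty zero_neq_one)
  with sub \<tau> show "{j. t j \<noteq> 0} \<in> finite_simplices J"
    by (auto simp: finite_simplices_def intro: finite_subset)
  show "t \<in> geometric_simplex {j. t j \<noteq> 0}"
    using t sum1 by (auto simp: geometric_simplex_def)
qed

lemma realization_convex:
  assumes "t \<in> topspace (realization J)" "u \<in> topspace (realization J)" "0 \<le> c" "c \<le> (1::real)"
  shows "(\<lambda>j. (1 - c) * t j + c * u j) \<in> topspace (realization J)"
proof -
  obtain \<tau> \<sigma> where \<tau>: "\<tau> \<in> finite_simplices J" "t \<in> geometric_simplex \<tau>"
    and \<sigma>: "\<sigma> \<in> finite_simplices J" "u \<in> geometric_simplex \<sigma>"
    using assms by (auto simp: topspace_realization)
  then have fin: "\<tau> \<union> \<sigma> \<in> finite_simplices J"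
    by (auto simp: finite_simplices_def)
  then have "t \<in> geometric_simplex (\<tau> \<union> \<sigma>)" "u \<in> geometric_simplex (\<tau> \<union> \<sigma>)"
    using \<tau> \<sigma> geometric_simplex_mono[of \<tau> "\<tau> \<union> \<sigma>"] geometric_simplex_mono[of \<sigma> "\<tau> \<union> \<sigma>"]
    by (auto simp: finite_simplices_def)
  then show ?thesis
    using fin geometric_simplex_convex assms(3,4) by (fastforce simp: topspace_realization)
qed

lemma compact_subset_simplex:
  assumes "compactin (realization J) K" "K \<noteq> {}"
  obtains \<tau> where "\<tau> \<in> finite_simplices J" "K \<subseteq> geometric_simplex \<tau>"
proof -
  have K: "K \<subseteq> topspace (realization J)"
    using assms compactin_subset_topspace by blast
  have "finite ((\<lambda>t. {j. t j \<noteq> 0}) ` K)"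
  proof (rule finite_labels_of_compact[OF assms(1)])
    fix S assume S: "S \<subseteq> topspace (realization J)"
      and fin: "\<And>\<tau>. \<tau> \<in> finite_simplices J \<Longrightarrow> finite (S \<inter> geometric_simplex \<tau>)"
    show "closedin (realization J) S"
      unfolding realization_def
    proof (rule closedin_coherent_topology)
      show "S \<subseteq> (\<Union>T\<in>(\<lambda>\<tau>. subtopology (powertop_real UNIV) (geometric_simplex \<tau>)) `
          finite_simplices J. topspace T)"
        using S by (simp add: topspace_realization)
    next
      fix T :: "('a \<Rightarrow> real) topology"
      assume "T \<in> (\<lambda>\<tau>. subtopology (powertop_real UNIV) (geometric_simplex \<tau>)) `
          finite_simplices J"
      then obtain \<tau> where \<tau>: "\<tau> \<in> finite_simplices J"
        and T: "T = top_of_set (geometric_simplex \<tau>)"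
        by (auto simp: subtopology_powertop_real)
      have "Hausdorff_space T"
        unfolding T subtopology_powertop_real[symmetric]
        by (simp add: Hausdorff_space_subtopology Hausdorff_space_product_topology)
      moreover have "finite (S \<inter> topspace T)"
        using fin[OF \<tau>] by (simp add: T)
      ultimately show "closedin T (S \<inter> topspace T)"
        by (simp add: closedin_Hausdorff_finite)
    qed
  next
    fix \<tau> assume \<tau>: "\<tau> \<in> finite_simplices J"
    then have "(\<lambda>t. {j. t j \<noteq> 0}) ` geometric_simplex \<tau> \<subseteq> Pow \<tau>"
      by (auto simp: geometric_simplex_def)
    moreover have "finite (Pow \<tau>)"
      using \<tau> by (simp add: finite_simplices_def)
    ultimately show "finite ((\<lambda>t. {j. t j \<noteq> 0}) ` geometric_simplex \<tau>)"
      by (rule finite_subset)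
  qed
  moreover
  define \<sigma> where "\<sigma> = (\<Union>t\<in>K. {j. t j \<noteq> 0})"
  moreover have "{j. t j \<noteq> 0} \<in> finite_simplices J" if "t \<in> K" for t
    using that K geometric_simplex_support by blast
  ultimately have \<sigma>: "\<sigma> \<in> finite_simplices J"
    using assms(2) by (fastforce simp: finite_simplices_def)
  have "K \<subseteq> geometric_simplex \<sigma>"
  proof
    fix t assume t: "t \<in> K"
    then have "t \<in> geometric_simplex {j. t j \<noteq> 0}"
      using K geometric_simplex_support by blast
    moreover have "{j. t j \<noteq> 0} \<subseteq> \<sigma>"
      using t by (auto simp: \<sigma>_def)
    ultimately show "t \<in> geometric_simplex \<sigma>"
      using \<sigma> geometric_simplex_mono by (auto simp: finite_simplices_def)
  qed
  with \<sigma> that show ?thesis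
    by blast
qed

lemma continuous_map_simplex_realization:
  assumes "\<tau> \<in> finite_simplices J"
  shows "continuous_map (top_of_set (geometric_simplex \<tau>)) (realization J) id"
  unfolding continuous_map_def
proof (intro conjI allI impI)
  show "id \<in> topspace (top_of_set (geometric_simplex \<tau>)) \<rightarrow> topspace (realization J)"
    using assms by (auto simp: topspace_realization)
  fix U assume U: "openin (realization J) U"
  have "openin (top_of_set (geometric_simplex \<tau>)) (U \<inter> geometric_simplex \<tau>)"
    using U assms by (fastforce simp: realization_def openin_coherent_topology subtopology_powertop_real)
  moreover have "{x \<in> topspace (top_of_set (geometric_simplex \<tau>)). id x \<in> U} = U \<inter> geometric_simplex \<tau>"
    by auto
  ultimately show "openin (top_of_set (geometric_simplex \<tau>))
      {x \<in> topspace (top_of_set (geometric_simplex \<tau>)). id x \<in> U}"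
    by simp
qed

lemma continuous_map_realization_euclidean: "continuous_map (realization J) euclidean id"
  unfolding continuous_map_def
proof (intro conjI allI impI)
  fix U :: "('a \<Rightarrow> real) set" assume U: "openin euclidean U"
  have "openin (top_of_set (geometric_simplex \<tau>)) (topspace (realization J) \<inter> U \<inter> geometric_simplex \<tau>)"
    if "\<tau> \<in> finite_simplices J" for \<tau>
  proof -
    have "topspace (realization J) \<inter> U \<inter> geometric_simplex \<tau> = geometric_simplex \<tau> \<inter> U"
      using that by (auto simp: topspace_realization)
    then show ?thesis
      using U by (simp add: openin_open_Int)
  qed
  then have "openin (realization J) (topspace (realization J) \<inter> U)"
    by (auto simp: realization_def openin_coherent_topology subtopology_powertop_real)
  moreover have "{x \<in> topspace (realization J). id x \<in> U} = topspace (realization J) \<inter> U"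
    by auto
  ultimately show "openin (realization J) {x \<in> topspace (realization J). id x \<in> U}"
    by simp
qed auto

text \<open>
  The coherent topology is under control only on compact sets, which is why the parameter space
  \<open>Z\<close> is a k-space: on a compact subset of \<open>Z\<close> both maps take values in one finite simplex, whose
  topology is Euclidean.
\<close>
lemma continuous_map_realization_convex:
  assumes Z: "k_space Z"
    and u: "continuous_map Z (realization J) u" and v: "continuous_map Z (realization J) v"
    and c: "continuous_map Z euclideanreal c" and c01: "c \<in> topspace Z \<rightarrow> {0..1}"
  shows "continuous_map Z (realization J) (\<lambda>z j. (1 - c z) * u z j + c z * v z j)"
proof (rule continuous_map_from_k_space[OF Z])
  fix K assume K: "compactin Z K"
  let ?w = "\<lambda>z j. (1 - c z) * u z j + c z * v z j"
  show "continuous_map (subtopology Z K) (realization J) ?w"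
  proof (cases "K = {}")
    case True
    then show ?thesis
      by (simp add: continuous_map_on_empty)
  next
    case False
    have "compactin (realization J) (u ` K \<union> v ` K)"
      using K u v by (intro compactin_Un image_compactin)
    then obtain \<tau> where \<tau>: "\<tau> \<in> finite_simplices J" "u ` K \<union> v ` K \<subseteq> geometric_simplex \<tau>"
      using False by (metis compact_subset_simplex image_is_empty sup_eq_bot_iff)
    have coord: "continuous_map (subtopology Z K) euclideanreal (\<lambda>z. f z j)"
      if "continuous_map Z (realization J) f" for f j
    proof -
      have "continuous_map Z (powertop_real UNIV) f"
        using continuous_map_compose[OF that continuous_map_realization_euclidean]
        by (simp add: euclidean_product_topology)
      then show ?thesis
        by (simp add: continuous_map_componentwise_UNIV continuous_map_from_subtopology)
    qed
    have "continuous_map (subtopology Z K) euclidean ?w"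
      unfolding euclidean_product_topology[symmetric] continuous_map_componentwise_UNIV
      using coord[OF u] coord[OF v] continuous_map_from_subtopology[OF c]
      by (intro allI continuous_intros) auto
    moreover have "?w z \<in> geometric_simplex \<tau>" if "z \<in> topspace (subtopology Z K)" for z
      using that \<tau>(2) c01 by (intro geometric_simplex_convex) auto
    ultimately have "continuous_map (subtopology Z K) (top_of_set (geometric_simplex \<tau>)) ?w"
      by (auto simp: continuous_map_in_subtopology)
    then show ?thesis
      using continuous_map_compose continuous_map_simplex_realization[OF \<tau>(1)] by fastforce
  qed
qed

section \<open>Characteristic maps\<close>

text \<open>
  The recursions below refer to the dimensions and the characteristic maps, so these are fixed here.
\<close>
locale cw_structure =
  fixes X :: "'x topology" and A :: "'a set" and e :: "'a \<Rightarrow> 'x set"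
    and d :: "'a \<Rightarrow> nat" and \<Phi> :: "'a \<Rightarrow> (nat \<Rightarrow> real) \<Rightarrow> 'x"
  assumes Hausdorff: "Hausdorff_space X"
    and cover: "topspace X = (\<Union>\<alpha>\<in>A. e \<alpha>)"
    and disjoint: "disjoint_family_on e A"
    and continuous_\<Phi>: "\<alpha> \<in> A \<Longrightarrow> continuous_map (top_of_set (closed_disk (d \<alpha>))) X (\<Phi> \<alpha>)"
    and bij_\<Phi>: "\<alpha> \<in> A \<Longrightarrow> bij_betw (\<Phi> \<alpha>) (open_disk (d \<alpha>)) (e \<alpha>)"
    and boundary: "\<alpha> \<in> A \<Longrightarrow> \<exists>B. finite B \<and> B \<subseteq> A \<and> (\<forall>\<beta>\<in>B. d \<beta> < d \<alpha>) \<and>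
             \<Phi> \<alpha> ` (closed_disk (d \<alpha>) - open_disk (d \<alpha>)) \<subseteq> (\<Union>\<beta>\<in>B. e \<beta>)"
    and coherent: "\<lbrakk>C \<subseteq> topspace X; \<And>\<alpha>. \<alpha> \<in> A \<Longrightarrow> closedin X (C \<inter> X closure_of e \<alpha>)\<rbrakk> \<Longrightarrow> closedin X C"

lemma cw_complex_imp_cw_structure:
  assumes "cw_complex X A e"
  shows "\<exists>d \<Phi>. cw_structure X A e d \<Phi>"
proof -
  from assms obtain d \<Phi> where
    cell: "\<And>\<alpha>. \<alpha> \<in> A \<Longrightarrow>
        continuous_map (subtopology (Euclidean_space (d \<alpha>)) (closed_disk (d \<alpha>))) X (\<Phi> \<alpha>) \<and>
        homeomorphic_map (subtopology (Euclidean_space (d \<alpha>)) (open_disk (d \<alpha>)))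
          (subtopology X (e \<alpha>)) (\<Phi> \<alpha>) \<and>
        (\<exists>B. finite B \<and> B \<subseteq> A \<and> (\<forall>\<beta>\<in>B. d \<beta> < d \<alpha>) \<and>
             \<Phi> \<alpha> ` (closed_disk (d \<alpha>) - open_disk (d \<alpha>)) \<subseteq> (\<Union>\<beta>\<in>B. e \<beta>))"
    and X: "Hausdorff_space X" "topspace X = (\<Union>\<alpha>\<in>A. e \<alpha>)" "disjoint_family_on e A"
      "\<forall>C \<subseteq> topspace X. (\<forall>\<alpha>\<in>A. closedin X (C \<inter> X closure_of e \<alpha>)) \<longrightarrow> closedin X C"
    unfolding cw_complex_def by metis
  have "bij_betw (\<Phi> \<alpha>) (open_disk (d \<alpha>)) (e \<alpha>)" if \<alpha>: "\<alpha> \<in> A" for \<alpha>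
  proof -
    have "homeomorphic_map (top_of_set (open_disk (d \<alpha>))) (subtopology X (e \<alpha>)) (\<Phi> \<alpha>)"
      using cell[OF \<alpha>] by (simp add: subtopology_disk open_disk_subset_closed_disk)
    moreover have "topspace X \<inter> e \<alpha> = e \<alpha>"
      using X(2) \<alpha> by auto
    ultimately show ?thesis
      by (auto simp: bij_betw_def homeomorphic_eq_everything_map)
  qed
  moreover have "continuous_map (top_of_set (closed_disk (d \<alpha>))) X (\<Phi> \<alpha>)" if "\<alpha> \<in> A" for \<alpha>
    using cell[OF that] by (simp add: subtopology_disk)
  ultimately have "cw_structure X A e d \<Phi>"
    using X cell by unfold_locales auto
  then show ?thesis
    by blast
qed

context cw_structure
begin

definition cell :: "'x \<Rightarrow> 'a" where
  "cell x = (THE \<alpha>. \<alpha> \<in> A \<and> x \<in> e \<alpha>)"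

text \<open>
  The following three describe a point by polar coordinates in its own open cell: the vector in the
  open disk, its norm, and the image of its radial projection to the sphere. The last is meaningful
  only for \<open>0 < radius x\<close>.
\<close>
definition coord :: "'x \<Rightarrow> nat \<Rightarrow> real" where
  "coord x = inv_into (open_disk (d (cell x))) (\<Phi> (cell x)) x"

definition radius :: "'x \<Rightarrow> real" where
  "radius x = radial_norm (d (cell x)) (coord x)"

definition boundary_point :: "'x \<Rightarrow> 'x" where
  "boundary_point x = \<Phi> (cell x) (scale_vec (1 / radius x) (coord x))"

abbreviation closed_cell :: "'a \<Rightarrow> 'x set" where
  "closed_cell \<alpha> \<equiv> \<Phi> \<alpha> ` closed_disk (d \<alpha>)"

lemma cell_eq:
  assumes "\<alpha> \<in> A" "x \<in> e \<alpha>"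
  shows "cell x = \<alpha>"
  unfolding cell_def
proof (rule the_equality)
  fix \<beta> assume "\<beta> \<in> A \<and> x \<in> e \<beta>"
  then show "\<beta> = \<alpha>"
    using assms disjoint by (auto simp: disjoint_family_on_def)
qed (use assms in simp)

lemma cell_in:
  assumes "x \<in> topspace X"
  shows "cell x \<in> A" "x \<in> e (cell x)"
  using assms cover cell_eq by auto

lemma coord_in:
  assumes "x \<in> topspace X"
  shows "coord x \<in> open_disk (d (cell x))" "\<Phi> (cell x) (coord x) = x"
  using cell_in[OF assms] bij_\<Phi>[of "cell x"]
  by (auto simp: coord_def bij_betw_def intro: inv_into_into f_inv_into_f[of x "\<Phi> (cell x)"])

lemma \<Phi>_in_topspace: "\<lbrakk>\<alpha> \<in> A; v \<in> closed_disk (d \<alpha>)\<rbrakk> \<Longrightarrow> \<Phi> \<alpha> v \<in> topspace X"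
  using continuous_\<Phi>[of \<alpha>] by (auto simp: continuous_map_def)

lemma \<Phi>_open_disk:
  assumes "\<alpha> \<in> A" "v \<in> open_disk (d \<alpha>)"
  shows "cell (\<Phi> \<alpha> v) = \<alpha>" "coord (\<Phi> \<alpha> v) = v"
proof -
  show *: "cell (\<Phi> \<alpha> v) = \<alpha>"
    using assms bij_\<Phi> by (intro cell_eq) (auto simp: bij_betw_def)
  show "coord (\<Phi> \<alpha> v) = v"
    unfolding coord_def * using assms bij_\<Phi> by (auto simp: bij_betw_def)
qed

lemma boundary_lower:
  assumes "\<alpha> \<in> A" "v \<in> closed_disk (d \<alpha>) - open_disk (d \<alpha>)"
  shows "d (cell (\<Phi> \<alpha> v)) < d \<alpha>"
proof -
  obtain B where "B \<subseteq> A" "\<forall>\<beta>\<in>B. d \<beta> < d \<alpha>"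
    "\<Phi> \<alpha> ` (closed_disk (d \<alpha>) - open_disk (d \<alpha>)) \<subseteq> (\<Union>\<beta>\<in>B. e \<beta>)"
    using boundary assms(1) by metis
  moreover from this obtain \<beta> where "\<beta> \<in> B" "\<Phi> \<alpha> v \<in> e \<beta>"
    using assms(2) by blast
  ultimately show ?thesis
    using cell_eq[of \<beta>] by auto
qed

lemma compact_closed_cell:
  assumes "\<alpha> \<in> A"
  shows "compactin X (closed_cell \<alpha>)"
  using image_compactin[OF _ continuous_\<Phi>[OF assms]] compact_closed_disk
  by (simp add: compactin_subtopology)

lemma cell_subset_closed_cell: "\<alpha> \<in> A \<Longrightarrow> e \<alpha> \<subseteq> closed_cell \<alpha>"
  using bij_\<Phi>[of \<alpha>] image_mono[OF open_disk_subset_closed_disk, of "\<Phi> \<alpha>" "d \<alpha>"]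
  by (simp add: bij_betw_def)

text \<open>
  A boundary point \<open>\<Phi> \<alpha> v\<close> of the closed disk is the limit of \<open>\<Phi> \<alpha> (c v)\<close> as \<open>c \<rightarrow> 1\<close>, and these
  points lie in the open cell.
\<close>
lemma closure_of_cell:
  assumes "\<alpha> \<in> A"
  shows "X closure_of e \<alpha> = closed_cell \<alpha>"
proof
  have "closedin X (closed_cell \<alpha>)"
    using compact_closed_cell assms Hausdorff compactin_imp_closedin by blast
  then show "X closure_of e \<alpha> \<subseteq> closed_cell \<alpha>"
    using cell_subset_closed_cell[OF assms] by (simp add: closure_of_minimal)
  show "closed_cell \<alpha> \<subseteq> X closure_of e \<alpha>"
  proof
    fix x assume "x \<in> closed_cell \<alpha>"
    then obtain v where v: "v \<in> closed_disk (d \<alpha>)" "x = \<Phi> \<alpha> v"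
      by blast
    have in_disk: "scale_vec c v \<in> closed_disk (d \<alpha>)" if "c \<in> {0..1}" for c
      using that v(1) by (intro scale_vec_in_closed_disk)
        (auto simp: closed_disk_iff mult_le_one radial_norm_nonneg)
    have "continuous_map (top_of_set {0..1}) (top_of_set (closed_disk (d \<alpha>))) (\<lambda>c. scale_vec c v)"
      using in_disk continuous_on_scale_vec[OF continuous_on_id continuous_on_const, of "{0..1}" v]
      by (auto simp: continuous_map_in_subtopology)
    from continuous_map_compose[OF this continuous_\<Phi>[OF assms]]
    have cont: "continuous_map (top_of_set {0..1}) X (\<lambda>c. \<Phi> \<alpha> (scale_vec c v))"
      by (simp add: o_def)
    have "(\<lambda>c. \<Phi> \<alpha> (scale_vec c v)) ` {0..<1} \<subseteq> e \<alpha>"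
    proof -
      have "scale_vec c v \<in> open_disk (d \<alpha>)" if "c \<in> {0..<1}" for c
      proof -
        have "c * radial_norm (d \<alpha>) v \<le> c * 1"
          using that v(1) by (intro mult_left_mono) (auto simp: closed_disk_iff)
        then show ?thesis
          using in_disk[of c] that
          by (auto simp: closed_disk_iff open_disk_iff radial_norm_scale)
      qed
      then show ?thesis
        using bij_\<Phi>[OF assms] by (auto simp: bij_betw_def)
    qed
    moreover have "1 \<in> top_of_set {0..1::real} closure_of {0..<1}"
      by (simp add: closure_of_subtopology Int_absorb1 atLeastLessThan_subseteq_atLeastAtMost_iff)
    then have "\<Phi> \<alpha> (scale_vec 1 v) \<in> X closure_of ((\<lambda>c. \<Phi> \<alpha> (scale_vec c v)) ` {0..<1})"
      using continuous_map_image_closure_subset[OF cont, of "{0..<1}"] by blast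
    ultimately have "\<Phi> \<alpha> (scale_vec 1 v) \<in> X closure_of e \<alpha>"
      using closure_of_mono by (metis subsetD)
    then show "x \<in> X closure_of e \<alpha>"
      by (simp add: v(2))
  qed
qed

lemma cell_order_\<Phi>:
  assumes "\<alpha> \<in> A" "v \<in> closed_disk (d \<alpha>)"
  shows "(cell (\<Phi> \<alpha> v), \<alpha>) \<in> cell_order X A e"
  unfolding cell_order_def
  using assms cell_in[OF \<Phi>_in_topspace[OF assms]] closure_of_cell[OF assms(1)]
  by (intro r_into_trancl) auto

lemma cell_order_trans:
  "\<lbrakk>(\<alpha>, \<beta>) \<in> cell_order X A e; (\<beta>, \<gamma>) \<in> cell_order X A e\<rbrakk> \<Longrightarrow> (\<alpha>, \<gamma>) \<in> cell_order X A e"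
  unfolding cell_order_def by (rule trancl_trans)

lemma cell_order_cell_refl: "x \<in> topspace X \<Longrightarrow> (cell x, cell x) \<in> cell_order X A e"
  using cell_order_\<Phi>[of "cell x" "coord x"] coord_in[of x] cell_in[of x]
    open_disk_subset_closed_disk by auto

lemma finite_cells_of_closed_cell:
  assumes "\<alpha> \<in> A"
  shows "finite (cell ` closed_cell \<alpha>)"
proof -
  obtain B where B: "finite B" "B \<subseteq> A"
    "\<Phi> \<alpha> ` (closed_disk (d \<alpha>) - open_disk (d \<alpha>)) \<subseteq> (\<Union>\<beta>\<in>B. e \<beta>)"
    using boundary assms by metis
  have "cell (\<Phi> \<alpha> v) \<in> insert \<alpha> B" if "v \<in> closed_disk (d \<alpha>)" for v
  proof (cases "v \<in> open_disk (d \<alpha>)")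
    case True
    then show ?thesis
      using \<Phi>_open_disk assms by simp
  next
    case False
    then have "\<Phi> \<alpha> v \<in> (\<Union>\<beta>\<in>B. e \<beta>)"
      using B(3) that by (meson DiffI image_subset_iff)
    then obtain \<beta> where "\<beta> \<in> B" "\<Phi> \<alpha> v \<in> e \<beta>"
      by blast
    then show ?thesis
      using B(2) cell_eq by auto
  qed
  then have "cell ` closed_cell \<alpha> \<subseteq> insert \<alpha> B"
    by blast
  then show ?thesis
    using B(1) by (meson finite_insert finite_subset)
qed

lemma compact_subset_closed_cells:
  assumes "compactin X K"
  obtains B where "finite B" "B \<subseteq> A" "K \<subseteq> (\<Union>\<beta>\<in>B. closed_cell \<beta>)"
proof
  have K: "K \<subseteq> topspace X"
    using assms compactin_subset_topspace by blast
  show "finite (cell ` K)"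
  proof (rule finite_labels_of_compact[OF assms])
    fix S assume S: "S \<subseteq> topspace X" and fin: "\<And>\<alpha>. \<alpha> \<in> A \<Longrightarrow> finite (S \<inter> closed_cell \<alpha>)"
    show "closedin X S"
    proof (rule coherent[OF S])
      fix \<alpha> assume "\<alpha> \<in> A"
      then show "closedin X (S \<inter> X closure_of e \<alpha>)"
        using fin S Hausdorff
        by (metis closure_of_cell closedin_Hausdorff_finite le_infI1)
    qed
  qed (rule finite_cells_of_closed_cell)
  show "cell ` K \<subseteq> A"
    using K cell_in by blast
  show "K \<subseteq> (\<Union>\<beta>\<in>cell ` K. closed_cell \<beta>)"
    using K cell_in cell_subset_closed_cell by fastforce
qed

lemma k_space_cw: "k_space X"
  unfolding k_space
proof (intro allI impI, elim conjE)
  fix S assume S: "S \<subseteq> topspace X"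
    and K: "\<forall>K. compactin X K \<longrightarrow> closedin (subtopology X K) (K \<inter> S)"
  show "closedin X S"
  proof (rule coherent[OF S])
    fix \<alpha> assume \<alpha>: "\<alpha> \<in> A"
    then have "closedin (subtopology X (closed_cell \<alpha>)) (closed_cell \<alpha> \<inter> S)"
      using K compact_closed_cell by blast
    moreover have "closedin X (closed_cell \<alpha>)"
      using compact_closed_cell[OF \<alpha>] Hausdorff compactin_imp_closedin by blast
    ultimately show "closedin X (S \<inter> X closure_of e \<alpha>)"
      using \<alpha> closedin_trans_full by (metis closure_of_cell inf_commute)
  qed
qed

text \<open>
  The parameter space \<open>P\<close> is needed because the homotopy is built cell by cell. For a single cell
  \<open>P \<times> D \<rightarrow> P \<times> closed_cell \<beta>\<close> is a surjection from a compact space to a Hausdorff space, so it is a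
  quotient map; finitely many closed pieces are pasted together.
\<close>
lemma continuous_on_finite_cells:
  assumes P: "compact_space P" "Hausdorff_space P"
    and B: "finite B" "B \<subseteq> A"
    and cont: "\<And>\<beta>. \<beta> \<in> B \<Longrightarrow>
      continuous_map (prod_topology P (top_of_set (closed_disk (d \<beta>)))) Y (\<lambda>(s, v). f (s, \<Phi> \<beta> v))"
  shows "continuous_map (prod_topology P (subtopology X (\<Union>\<beta>\<in>B. closed_cell \<beta>))) Y f"
proof (rule pasting_lemma_closed[OF B(1), where T = "\<lambda>\<beta>. topspace P \<times> closed_cell \<beta>"])
  let ?S = "\<Union>\<beta>\<in>B. closed_cell \<beta>"
  fix \<beta> assume \<beta>: "\<beta> \<in> B"
  then have \<beta>A: "\<beta> \<in> A"
    using B by blast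
  have closed_in_top: "closed_cell \<beta> \<subseteq> topspace X"
    using \<Phi>_in_topspace[OF \<beta>A] by blast
  have "closedin X (closed_cell \<beta>)"
    using compact_closed_cell[OF \<beta>A] Hausdorff compactin_imp_closedin by blast
  then show "closedin (prod_topology P (subtopology X ?S)) (topspace P \<times> closed_cell \<beta>)"
    using \<beta> by (auto simp: closedin_prod_Times_iff intro!: closedin_subset_topspace)
  have "subtopology (prod_topology P (subtopology X ?S)) (topspace P \<times> closed_cell \<beta>)
      = prod_topology P (subtopology X (closed_cell \<beta>))"
  proof -
    have "?S \<inter> closed_cell \<beta> = closed_cell \<beta>"
      using \<beta> by blast
    then show ?thesis
      by (simp add: subtopology_Times subtopology_subtopology)
  qed
  moreover
  let ?q = "\<lambda>(s, v). (s, \<Phi> \<beta> v)"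
  let ?D = "prod_topology P (top_of_set (closed_disk (d \<beta>)))"
  have "quotient_map ?D (prod_topology P (subtopology X (closed_cell \<beta>))) ?q"
  proof (rule continuous_imp_quotient_map)
    have "continuous_map (top_of_set (closed_disk (d \<beta>))) (subtopology X (closed_cell \<beta>)) (\<Phi> \<beta>)"
      using continuous_\<Phi>[OF \<beta>A] by (simp add: continuous_map_in_subtopology)
    then show "continuous_map ?D (prod_topology P (subtopology X (closed_cell \<beta>))) ?q"
      by (simp add: continuous_map_prod_top)
    show "compact_space ?D"
      using P compact_closed_disk by (simp add: compact_space_prod_topology compact_space_subtopology)
    show "Hausdorff_space (prod_topology P (subtopology X (closed_cell \<beta>)))"
      using P Hausdorff by (simp add: Hausdorff_space_prod_topology Hausdorff_space_subtopology)
    show "?q ` topspace ?D = topspace (prod_topology P (subtopology X (closed_cell \<beta>)))"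
      using closed_in_top by force
  qed
  moreover have "continuous_map ?D Y (f \<circ> ?q)"
    using cont[OF \<beta>] by (simp add: o_def case_prod_unfold)
  ultimately show "continuous_map
      (subtopology (prod_topology P (subtopology X ?S)) (topspace P \<times> closed_cell \<beta>)) Y f"
    by (simp add: continuous_compose_quotient_map)
qed auto

text \<open>
  \<open>P \<times> X\<close> is a k-space since \<open>P\<close> is locally compact, and a compact subset of it lies over finitely
  many closed cells.
\<close>
lemma continuous_by_cells:
  assumes P: "compact_space P" "Hausdorff_space P"
    and cont: "\<And>\<beta>. \<beta> \<in> A \<Longrightarrow>
      continuous_map (prod_topology P (top_of_set (closed_disk (d \<beta>)))) Y (\<lambda>(s, v). f (s, \<Phi> \<beta> v))"
  shows "continuous_map (prod_topology P X) Y f"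
proof (rule continuous_map_from_k_space)
  show "k_space (prod_topology P X)"
    using P k_space_cw by (simp add: k_space_prod_topology_left compact_imp_locally_compact_space)
  fix K assume K: "compactin (prod_topology P X) K"
  then have "compactin X (snd ` K)"
    by (rule image_compactin) (rule continuous_map_snd)
  then obtain B where B: "finite B" "B \<subseteq> A" "snd ` K \<subseteq> (\<Union>\<beta>\<in>B. closed_cell \<beta>)"
    by (rule compact_subset_closed_cells)
  have "continuous_map (prod_topology P (subtopology X (\<Union>\<beta>\<in>B. closed_cell \<beta>))) Y f"
    using P B cont by (intro continuous_on_finite_cells) auto
  then have "continuous_map (subtopology (prod_topology P X)
      (topspace P \<times> (\<Union>\<beta>\<in>B. closed_cell \<beta>))) Y f"
    by (simp add: subtopology_Times)
  moreover have "K \<subseteq> topspace P \<times> (\<Union>\<beta>\<in>B. closed_cell \<beta>)"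
    using compactin_subset_topspace[OF K] B(3) by force
  ultimately show "continuous_map (subtopology (prod_topology P X) K) Y f"
    by (rule continuous_map_from_subtopology_mono)
qed

text \<open>
  The induction step on dimension: closure-finiteness turns continuity on the cells of lower dimension into
  continuity on the boundary sphere.
\<close>
lemma continuous_on_boundary:
  assumes P: "compact_space P" "Hausdorff_space P" and \<alpha>: "\<alpha> \<in> A"
    and cont: "\<And>\<beta>. \<lbrakk>\<beta> \<in> A; d \<beta> < d \<alpha>\<rbrakk> \<Longrightarrow>
      continuous_map (prod_topology P (top_of_set (closed_disk (d \<beta>)))) Y (\<lambda>(s, v). f (s, \<Phi> \<beta> v))"
  shows "continuous_map (prod_topology P (top_of_set (closed_disk (d \<alpha>) - open_disk (d \<alpha>)))) Y
    (\<lambda>(s, v). f (s, \<Phi> \<alpha> v))"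
proof -
  let ?S = "closed_disk (d \<alpha>) - open_disk (d \<alpha>)"
  obtain B where B: "finite B" "B \<subseteq> A" "\<forall>\<beta>\<in>B. d \<beta> < d \<alpha>" "\<Phi> \<alpha> ` ?S \<subseteq> (\<Union>\<beta>\<in>B. e \<beta>)"
    using boundary \<alpha> by metis
  have "continuous_map (prod_topology P (subtopology X (\<Union>\<beta>\<in>B. closed_cell \<beta>))) Y f"
    using P B cont by (intro continuous_on_finite_cells) auto
  moreover
  have "\<Phi> \<alpha> ` ?S \<subseteq> (\<Union>\<beta>\<in>B. closed_cell \<beta>)"
    using B(2,4) cell_subset_closed_cell by blast
  then have "continuous_map (top_of_set ?S) (subtopology X (\<Union>\<beta>\<in>B. closed_cell \<beta>)) (\<Phi> \<alpha>)"
    using continuous_map_from_subtopology_mono[OF continuous_\<Phi>[OF \<alpha>], of ?S]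
    by (auto simp: continuous_map_in_subtopology)
  then have "continuous_map (prod_topology P (top_of_set ?S))
      (prod_topology P (subtopology X (\<Union>\<beta>\<in>B. closed_cell \<beta>))) (\<lambda>(s, v). (s, \<Phi> \<alpha> v))"
    by (simp add: continuous_map_prod_top)
  from continuous_map_compose[OF this calculation] show ?thesis
    by (simp add: o_def case_prod_unfold)
qed

subsection \<open>The collapsing homotopy and the weights\<close>

definition push_end_time :: "real \<Rightarrow> real \<Rightarrow> real" where
  "push_end_time s r = min s (2 * (r * (1 + s) - 1))"

lemma radius_bounds:
  assumes "x \<in> topspace X"
  shows "0 \<le> radius x" "radius x < 1"
  using coord_in[OF assms] by (auto simp: radius_def radial_norm_nonneg open_disk_iff)

lemma boundary_point_\<Phi>:
  assumes "x \<in> topspace X" "0 < radius x"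
  shows "scale_vec (1 / radius x) (coord x) \<in> closed_disk (d (cell x)) - open_disk (d (cell x))"
  using normalize_in_boundary_disk[of "coord x" "d (cell x)"] assms coord_in(1)[OF assms(1)]
    open_disk_subset_closed_disk by (auto simp: radius_def)

lemma boundary_point_in:
  assumes "x \<in> topspace X" "0 < radius x"
  shows "boundary_point x \<in> topspace X" "d (cell (boundary_point x)) < d (cell x)"
    "(cell (boundary_point x), cell x) \<in> cell_order X A e"
  using boundary_point_\<Phi>[OF assms] cell_in[OF assms(1)] \<Phi>_in_topspace boundary_lower cell_order_\<Phi>
  by (auto simp: boundary_point_def)

text \<open>
  At time \<open>s\<close> the open cell is expanded radially by the factor \<open>1 + s\<close>. A point that is
  expanded beyond the unit sphere is first projected to the sphere and then moved by the homotopy of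
  the boundary, up to the time \<open>push_end_time s r\<close>. This time is \<open>0\<close> for points that just reach
  the sphere, so that the two cases agree there, and it is \<open>s\<close> for \<open>r = 1\<close>, so that \<open>push s\<close> extends the
  homotopy of the boundary. At \<open>s = 1\<close> it has reached \<open>1\<close> for \<open>r \<ge> 3/4\<close>, which leaves room for the
  interpolation in \<open>weight\<close>.
\<close>
function push :: "real \<Rightarrow> 'x \<Rightarrow> 'x" where
  "push s x =
    (if x \<in> topspace X \<and> 1 < radius x * (1 + s)
     then push (push_end_time s (radius x)) (boundary_point x)
     else \<Phi> (cell x) (scale_vec (1 + s) (coord x)))"
  by auto
termination
proof (relation "Wellfounded.measure (\<lambda>(s, x). d (cell x))")
  fix s x assume *: "x \<in> topspace X \<and> 1 < radius x * (1 + s)"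
  then have "radius x \<noteq> 0"
    by auto
  with * show "((push_end_time s (radius x), boundary_point x), s, x) \<in> Wellfounded.measure (\<lambda>(s, x). d (cell x))"
    using boundary_point_in radius_bounds[of x] by auto
qed simp

text \<open>
  The interpolation starts at radius \<open>3/4\<close>, where \<open>push 1 x\<close> begins to coincide with
  \<open>push 1 (boundary_point x)\<close>, and reaches the value at the boundary point at radius \<open>1\<close>.
\<close>
function weight :: "('a \<Rightarrow> 'j) \<Rightarrow> 'x \<Rightarrow> 'j \<Rightarrow> real" where
  "weight pick x =
    (if x \<in> topspace X \<and> 3/4 < radius x
     then (\<lambda>j. (1 - (4 * radius x - 3)) * of_bool (j = pick (cell x))
            + (4 * radius x - 3) * weight pick (boundary_point x) j)
     else (\<lambda>j. of_bool (j = pick (cell x))))"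
  by auto
termination
proof (relation "Wellfounded.measure (\<lambda>(pick, x). d (cell x))")
  fix pick :: "'a \<Rightarrow> 'j" and x assume *: "x \<in> topspace X \<and> 3/4 < radius x"
  then show "((pick, boundary_point x), pick, x) \<in> Wellfounded.measure (\<lambda>(pick, x). d (cell x))"
    using boundary_point_in[of x] by auto
qed simp

declare push.simps [simp del] weight.simps [simp del]

lemma push_end_time_bounds:
  assumes "s \<in> {0..1}" "1 < r * (1 + s)"
  shows "push_end_time s r \<in> {0..1}"
  using assms by (auto simp: push_end_time_def)

lemma push_0:
  assumes "x \<in> topspace X"
  shows "push 0 x = x"
  using radius_bounds[OF assms] coord_in[OF assms] by (subst push.simps) simp

lemma push_cell_order:
  assumes "x \<in> topspace X" "s \<in> {0..1}"
  shows "push s x \<in> topspace X \<and> (cell (push s x), cell x) \<in> cell_order X A e"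
  using assms
proof (induction s x rule: push.induct)
  case (1 s x)
  show ?case
  proof (cases "1 < radius x * (1 + s)")
    case True
    then have r: "0 < radius x"
      using radius_bounds[OF 1(2)] by (cases "radius x = 0") auto
    show ?thesis
      using 1 True boundary_point_in[OF 1(2) r] push_end_time_bounds[OF 1(3) True] cell_order_trans
      by (subst (1 2) push.simps) auto
  next
    case False
    then have "scale_vec (1 + s) (coord x) \<in> closed_disk (d (cell x))"
      using 1 coord_in[OF 1(2)] open_disk_subset_closed_disk
      by (intro scale_vec_in_closed_disk) (auto simp: radius_def mult.commute)
    then show ?thesis
      using False cell_in[OF 1(2)] \<Phi>_in_topspace cell_order_\<Phi>
      by (subst (1 2) push.simps) auto
  qed
qed

text \<open>
  The recursion equations hold on closed disks, in which form they are suited to continuity arguments: for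
  \<open>r = 1\<close> they say nothing new because \<open>push_end_time s 1 = s\<close>.
\<close>
lemma push_\<Phi>:
  assumes "\<alpha> \<in> A" "v \<in> closed_disk (d \<alpha>)" "s \<in> {0..1}"
  defines "r \<equiv> radial_norm (d \<alpha>) v"
  shows "push s (\<Phi> \<alpha> v) =
    (if 1 < r * (1 + s) then push (push_end_time s r) (\<Phi> \<alpha> (scale_vec (1 / r) v))
     else \<Phi> \<alpha> (scale_vec (1 + s) v))"
proof (cases "v \<in> open_disk (d \<alpha>)")
  case True
  then show ?thesis
    using assms \<Phi>_in_topspace by (subst push.simps) (simp add: \<Phi>_open_disk radius_def boundary_point_def)
next
  case False
  then have "r = 1"
    using assms boundary_disk_iff[of v "d \<alpha>"] by simp
  then show ?thesis
    using assms \<Phi>_in_topspace by (auto simp: push_end_time_def push_0)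
qed

lemma weight_\<Phi>:
  assumes "\<alpha> \<in> A" "v \<in> closed_disk (d \<alpha>)"
  defines "r \<equiv> radial_norm (d \<alpha>) v"
  shows "weight pick (\<Phi> \<alpha> v) =
    (if 3/4 < r
     then (\<lambda>j. (1 - (4 * r - 3)) * of_bool (j = pick \<alpha>)
            + (4 * r - 3) * weight pick (\<Phi> \<alpha> (scale_vec (1 / r) v)) j)
     else (\<lambda>j. of_bool (j = pick \<alpha>)))"
proof (cases "v \<in> open_disk (d \<alpha>)")
  case True
  then show ?thesis
    using assms \<Phi>_in_topspace
    by (subst weight.simps) (simp add: \<Phi>_open_disk radius_def boundary_point_def)
next
  case False
  then have "r = 1"
    using assms boundary_disk_iff[of v "d \<alpha>"] by simp
  then show ?thesis
    by simp
qed

lemma weight_in_realization: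
  assumes "pick ` A \<subseteq> J" "x \<in> topspace X"
  shows "weight pick x \<in> topspace (realization J)"
  using assms
proof (induction pick x rule: weight.induct)
  case (1 pick x)
  have vertex: "(\<lambda>j. of_bool (j = pick (cell x))) \<in> topspace (realization J)"
    using 1 cell_in by (intro vertex_in_realization) auto
  show ?case
  proof (cases "3/4 < radius x")
    case True
    then show ?thesis
      using 1 boundary_point_in[of x] radius_bounds[of x]
        realization_convex[OF vertex, of "weight pick (boundary_point x)" "4 * radius x - 3"]
      by (subst weight.simps) auto
  next
    case False
    then show ?thesis
      by (subst weight.simps) (simp add: vertex)
  qed
qed

text \<open>
  In the collar of radius greater than \<open>3/4\<close> the points \<open>x\<close> and \<open>boundary_point x\<close> have the same
  image under \<open>push 1\<close>; so the new vertex \<open>pick (cell x)\<close> is admissible together with those that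
  the weight of the boundary point already uses.
\<close>
lemma weight_support:
  assumes "x \<in> topspace X" "weight pick x j \<noteq> 0"
  shows "\<exists>\<beta>. (\<beta>, cell x) \<in> cell_order X A e \<and> (cell (push 1 x), \<beta>) \<in> cell_order X A e \<and> pick \<beta> = j"
  using assms
proof (induction pick x rule: weight.induct)
  case (1 pick x)
  show ?case
  proof (cases "j = pick (cell x)")
    case True
    then show ?thesis
      using push_cell_order[of x 1] cell_order_cell_refl 1 by force
  next
    case False
    then have r: "3/4 < radius x" and w: "weight pick (boundary_point x) j \<noteq> 0"
      using 1(3) by (subst (asm) weight.simps; simp split: if_splits)+
    have b: "boundary_point x \<in> topspace X" "(cell (boundary_point x), cell x) \<in> cell_order X A e"
      using boundary_point_in[OF 1(2)] r by auto
    obtain \<beta> where \<beta>: "(\<beta>, cell (boundary_point x)) \<in> cell_order X A e"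
      "(cell (push 1 (boundary_point x)), \<beta>) \<in> cell_order X A e" "pick \<beta> = j"
      using 1(1)[OF _ b(1) w] 1(2) r by auto
    moreover have "push 1 x = push 1 (boundary_point x)"
      using 1(2) r by (subst push.simps) (simp add: push_end_time_def)
    ultimately show ?thesis
      using b(2) cell_order_trans by metis
  qed
qed

text \<open>
  Continuity of vector-valued maps is proved with \<open>continuous_on_scale_vec\<close> from here on; splitting
  them into coordinates first would make that rule inapplicable.
\<close>
declare continuous_on_coordinatewise_then_product [continuous_intros del]

text \<open>
  By induction on the dimension, \<open>push\<close> is continuous on \<open>[0,1] \<times> D\<close> for every characteristic map.
  On the part that has reached the sphere it is the composite of the homotopy of the boundary with a
  continuous map to \<open>[0,1]\<close> times the sphere, on the rest it is a rescaling, and where both parts meet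
  the remaining time is \<open>0\<close>.
\<close>
lemma continuous_push: "continuous_map (prod_topology (top_of_set {0..1}) X) X (\<lambda>(s, x). push s x)"
proof -
  let ?I = "top_of_set {0..1::real}"
  have I: "compact_space ?I" "Hausdorff_space ?I"
    by (auto simp: compact_space_subtopology Hausdorff_space_subtopology)
  have "continuous_map (prod_topology ?I (top_of_set (closed_disk (d \<alpha>)))) X (\<lambda>(s, v). push s (\<Phi> \<alpha> v))"
    if "\<alpha> \<in> A" for \<alpha>
    using that
  proof (induction "d \<alpha>" arbitrary: \<alpha> rule: less_induct)
    case less
    let ?D = "closed_disk (d \<alpha>)"
    let ?r = "\<lambda>v. radial_norm (d \<alpha>) v"
    let ?p = "\<lambda>z :: real \<times> (nat \<Rightarrow> real). ?r (snd z) * (1 + fst z)"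
    let ?S = "closed_disk (d \<alpha>) - open_disk (d \<alpha>)"
    let ?Q = "top_of_set ({0..1} \<times> ?D)"
    have bd: "continuous_map (prod_topology ?I (top_of_set ?S)) X (\<lambda>z. push (fst z) (\<Phi> \<alpha> (snd z)))"
      using continuous_on_boundary[OF I less.prems, of X "\<lambda>(s, x). push s x"] less.hyps
      by (simp add: case_prod_unfold)
    have p: "continuous_map ?Q euclideanreal ?p"
      by (auto intro!: continuous_intros)
    have "continuous_map ?Q X (\<lambda>z. if 1 < ?p z
        then push (push_end_time (fst z) (?r (snd z))) (\<Phi> \<alpha> (scale_vec (1 / ?r (snd z)) (snd z)))
        else \<Phi> \<alpha> (scale_vec (1 + fst z) (snd z)))"
    proof (rule continuous_map_cases_lt[OF _ p])
      let ?T = "{z \<in> topspace ?Q. 1 \<le> ?p z}"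
      have r_pos: "?r (snd z) \<noteq> 0" if "z \<in> ?T" for z
        using that by (cases "?r (snd z) = 0") auto
      let ?g = "\<lambda>z. (push_end_time (fst z) (?r (snd z)), scale_vec (1 / ?r (snd z)) (snd z))"
      have "continuous_on ?T ?g"
        unfolding push_end_time_def using r_pos by (intro continuous_intros) auto
      moreover have "?g z \<in> {0..1} \<times> ?S" if "z \<in> ?T" for z
      proof -
        have "0 < ?r (snd z)"
          using r_pos[OF that] radial_norm_nonneg[of "d \<alpha>" "snd z"] by simp
        then have "scale_vec (1 / ?r (snd z)) (snd z) \<in> ?S"
          using that by (intro normalize_in_boundary_disk) auto
        moreover have "push_end_time (fst z) (?r (snd z)) \<in> {0..1}"
          using that by (auto simp: push_end_time_def)
        ultimately show ?thesis
          by simp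
      qed
      ultimately have "continuous_map (top_of_set ?T) (prod_topology ?I (top_of_set ?S)) ?g"
        by (auto simp: continuous_map_in_subtopology)
      from continuous_map_compose[OF this bd]
      show "continuous_map (subtopology ?Q ?T) X (\<lambda>z. push (push_end_time (fst z) (?r (snd z)))
          (\<Phi> \<alpha> (scale_vec (1 / ?r (snd z)) (snd z))))"
        by (simp add: o_def subtopology_subtopology Int_absorb1)
    next
      let ?T = "{z \<in> topspace ?Q. ?p z \<le> 1}"
      have "continuous_on ?T (\<lambda>z. scale_vec (1 + fst z) (snd z))"
        by (intro continuous_intros)
      moreover have "scale_vec (1 + fst z) (snd z) \<in> ?D" if "z \<in> ?T" for z
        using that by (intro scale_vec_in_closed_disk) (auto simp: mult.commute)
      ultimately have "continuous_map (top_of_set ?T) (top_of_set ?D) (\<lambda>z. scale_vec (1 + fst z) (snd z))"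
        by (auto simp: continuous_map_in_subtopology)
      from continuous_map_compose[OF this continuous_\<Phi>[OF less.prems]]
      show "continuous_map (subtopology ?Q ?T) X (\<lambda>z. \<Phi> \<alpha> (scale_vec (1 + fst z) (snd z)))"
        by (simp add: o_def subtopology_subtopology Int_absorb1)
    next
      fix z assume z: "z \<in> topspace ?Q" "1 = ?p z"
      then have r: "?r (snd z) \<noteq> 0"
        by auto
      then have s: "1 / ?r (snd z) = 1 + fst z"
        using z(2) by (simp add: field_simps)
      have "push_end_time (fst z) (?r (snd z)) = 0"
        using z by (auto simp: push_end_time_def)
      moreover have "\<Phi> \<alpha> (scale_vec (1 + fst z) (snd z)) \<in> topspace X"
        using z less.prems by (intro \<Phi>_in_topspace scale_vec_in_closed_disk) (auto simp: mult.commute)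
      ultimately show "push (push_end_time (fst z) (?r (snd z)))
            (\<Phi> \<alpha> (scale_vec (1 / ?r (snd z)) (snd z)))
          = \<Phi> \<alpha> (scale_vec (1 + fst z) (snd z))"
        by (simp add: s push_0)
    qed simp
    then have "continuous_map ?Q X (\<lambda>(s, v). push s (\<Phi> \<alpha> v))"
      by (rule continuous_map_eq) (auto simp: push_\<Phi>[OF less.prems])
    then show ?case
      by simp
  qed
  then show ?thesis
    by (intro continuous_by_cells[OF I]) auto
qed

text \<open>
  The same induction as for \<open>push\<close>, with the interval as an idle parameter. The outer part of the disk
  is compact, so convex combinations are continuous there.
\<close>
lemma continuous_weight:
  assumes pick: "pick ` A \<subseteq> J"
  shows "continuous_map X (realization J) (weight pick)"
proof -
  let ?I = "top_of_set {0..1::real}"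
  have I: "compact_space ?I" "Hausdorff_space ?I"
    by (auto simp: compact_space_subtopology Hausdorff_space_subtopology)
  have disk: "continuous_map (top_of_set (closed_disk (d \<alpha>))) (realization J) (\<lambda>v. weight pick (\<Phi> \<alpha> v))"
    if "\<alpha> \<in> A" for \<alpha>
    using that
  proof (induction "d \<alpha>" arbitrary: \<alpha> rule: less_induct)
    case less
    let ?D = "closed_disk (d \<alpha>)"
    let ?S = "closed_disk (d \<alpha>) - open_disk (d \<alpha>)"
    let ?r = "\<lambda>v. radial_norm (d \<alpha>) v"
    have "continuous_map (prod_topology ?I (top_of_set (closed_disk (d \<beta>)))) (realization J)
        (\<lambda>(s, v). weight pick (\<Phi> \<beta> v))" if "\<beta> \<in> A" "d \<beta> < d \<alpha>" for \<beta>
      using continuous_map_compose[OF continuous_map_snd[of ?I] less.hyps[OF that(2,1)]]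
      by (simp add: o_def case_prod_unfold)
    then have w: "continuous_map (prod_topology ?I (top_of_set ?S)) (realization J)
        (\<lambda>(s, v). weight pick (\<Phi> \<alpha> v))"
      using continuous_on_boundary[OF I less.prems, of "realization J" "\<lambda>(s, x). weight pick x"]
      by (simp add: case_prod_unfold)
    have "continuous_map (top_of_set ?S) (prod_topology ?I (top_of_set ?S)) (\<lambda>v. (0, v))"
      by (auto simp: continuous_map_in_subtopology intro!: continuous_intros)
    from continuous_map_compose[OF this w]
    have bd: "continuous_map (top_of_set ?S) (realization J) (\<lambda>v. weight pick (\<Phi> \<alpha> v))"
      by (simp add: o_def)
    have vertex: "(\<lambda>j. of_bool (j = pick \<alpha>)) \<in> topspace (realization J)"
      using pick less.prems by (intro vertex_in_realization) auto
    have r: "continuous_map (top_of_set ?D) euclideanreal ?r"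
      by (auto intro!: continuous_intros)
    have cases: "continuous_map (top_of_set ?D) (realization J) (\<lambda>v. if 3/4 < ?r v
        then (\<lambda>j. (1 - (4 * ?r v - 3)) * of_bool (j = pick \<alpha>)
            + (4 * ?r v - 3) * weight pick (\<Phi> \<alpha> (scale_vec (1 / ?r v) v)) j)
        else (\<lambda>j. of_bool (j = pick \<alpha>)))"
    proof (rule continuous_map_cases_lt[OF _ r])
      let ?T = "{v \<in> topspace (top_of_set ?D). 3/4 \<le> ?r v}"
      have T: "subtopology (top_of_set ?D) ?T = top_of_set ?T"
        by (simp add: subtopology_subtopology Int_absorb1)
      have "?T = ?D \<inter> {v. 3/4 \<le> ?r v}"
        by auto
      then have "compact ?T"
        by (auto intro!: compact_Int_closed compact_closed_disk closed_Collect_le continuous_intros)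
      then have k: "k_space (top_of_set ?T)"
        by (intro compact_imp_k_space) (simp add: compact_space_subtopology)
      have "continuous_on ?T (\<lambda>v. scale_vec (1 / ?r v) v)"
        by (intro continuous_intros) auto
      moreover have "scale_vec (1 / ?r v) v \<in> ?S" if "v \<in> ?T" for v
        using that by (intro normalize_in_boundary_disk) auto
      ultimately have "continuous_map (top_of_set ?T) (top_of_set ?S) (\<lambda>v. scale_vec (1 / ?r v) v)"
        by (auto simp: continuous_map_in_subtopology)
      from continuous_map_compose[OF this bd]
      have w: "continuous_map (top_of_set ?T) (realization J)
          (\<lambda>v. weight pick (\<Phi> \<alpha> (scale_vec (1 / ?r v) v)))"
        by (simp add: o_def)
      show "continuous_map (subtopology (top_of_set ?D) ?T) (realization J)
          (\<lambda>v j. (1 - (4 * ?r v - 3)) * of_bool (j = pick \<alpha>)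
            + (4 * ?r v - 3) * weight pick (\<Phi> \<alpha> (scale_vec (1 / ?r v) v)) j)"
        unfolding T
      proof (rule continuous_map_realization_convex[OF k _ w])
        show "continuous_map (top_of_set ?T) (realization J) (\<lambda>v j. of_bool (j = pick \<alpha>))"
          using vertex by simp
        show "continuous_map (top_of_set ?T) euclideanreal (\<lambda>v. 4 * ?r v - 3)"
          by (auto intro!: continuous_intros)
        show "(\<lambda>v. 4 * ?r v - 3) \<in> topspace (top_of_set ?T) \<rightarrow> {0..1}"
          by (auto simp: closed_disk_iff)
      qed
    next
      fix v assume "3/4 = ?r v"
      then have "4 * ?r v - 3 = 0"
        by simp
      then show "(\<lambda>j. (1 - (4 * ?r v - 3)) * of_bool (j = pick \<alpha>)
            + (4 * ?r v - 3) * weight pick (\<Phi> \<alpha> (scale_vec (1 / ?r v) v)) j)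
          = (\<lambda>j. of_bool (j = pick \<alpha>))"
        by (simp only:) simp
    qed (use vertex in simp_all)
    from cases show ?case
      by (rule continuous_map_eq) (auto simp: weight_\<Phi>[OF less.prems])
  qed
  have w: "continuous_map (prod_topology ?I X) (realization J) (\<lambda>(s, x). weight pick x)"
  proof (rule continuous_by_cells[OF I])
    fix \<beta> assume "\<beta> \<in> A"
    from continuous_map_compose[OF continuous_map_snd[of ?I] disk[OF this]]
    show "continuous_map (prod_topology ?I (top_of_set (closed_disk (d \<beta>)))) (realization J)
        (\<lambda>(s, v). case (s, \<Phi> \<beta> v) of (s, x) \<Rightarrow> weight pick x)"
      by (simp add: o_def case_prod_unfold)
  qed
  have "continuous_map X (prod_topology ?I X) (\<lambda>x. (0, x))"
    by (auto simp: continuous_map_pairwise o_def)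
  from continuous_map_compose[OF this w] show ?thesis
    by (simp add: o_def)
qed

end

section \<open>The projection as a homotopy equivalence\<close>

lemma homotopic_with_subtopologyI:
  assumes h: "continuous_map (prod_topology (top_of_set {0..1::real}) W) W h"
    and im: "\<And>s x. \<lbrakk>s \<in> {0..1}; x \<in> topspace W \<inter> S\<rbrakk> \<Longrightarrow> h (s, x) \<in> S"
    and 0: "\<And>x. x \<in> topspace W \<inter> S \<Longrightarrow> h (0, x) = f x"
    and 1: "\<And>x. x \<in> topspace W \<inter> S \<Longrightarrow> h (1, x) = g x"
  shows "homotopic_with (\<lambda>_. True) (subtopology W S) (subtopology W S) f g"
proof -
  have "continuous_map (subtopology (prod_topology (top_of_set {0..1}) W) (UNIV \<times> S)) W h"
    by (rule continuous_map_from_subtopology[OF h])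
  then have "continuous_map (prod_topology (top_of_set {0..1}) (subtopology W S)) (subtopology W S) h"
    using im by (auto simp: subtopology_Times continuous_map_in_subtopology)
  then show ?thesis
    using 0 1 by (subst homotopic_with) auto
qed

lemma homotopy_equivalence_map_trivial:
  "homotopy_equivalence_map trivial_topology trivial_topology f"
  unfolding homotopy_equivalence_map_def
  by (auto intro!: homotopic_with_equal)

context cw_structure
begin

lemma cell_order_in_A:
  assumes "(\<beta>, \<alpha>) \<in> cell_order X A e"
  shows "\<beta> \<in> A" "\<alpha> \<in> A"
  using assms unfolding cell_order_def by (induction rule: trancl_induct) auto

lemma closure_of_cell_order:
  assumes "\<alpha> \<in> A" "x \<in> X closure_of e \<alpha>"
  shows "x \<in> topspace X" "(cell x, \<alpha>) \<in> cell_order X A e"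
  using assms \<Phi>_in_topspace cell_order_\<Phi> by (auto simp: closure_of_cell)

lemma in_closure_of_own_cell: "x \<in> topspace X \<Longrightarrow> x \<in> X closure_of e (cell x)"
  using cell_in cell_subset_closed_cell closure_of_cell by blast

lemma rel_domain_complex_eq:
  assumes R: "R \<subseteq> A \<times> J"
    and down: "\<And>\<alpha> \<beta> j. \<lbrakk>(\<alpha>, j) \<in> R; (\<beta>, \<alpha>) \<in> cell_order X A e\<rbrakk> \<Longrightarrow> (\<beta>, j) \<in> R"
  shows "rel_domain_complex X e R = subtopology X {x \<in> topspace X. \<exists>j. (cell x, j) \<in> R}"
proof -
  have "\<Union>{X closure_of e \<alpha> | \<alpha>. \<exists>j. (\<alpha>, j) \<in> R} = {x \<in> topspace X. \<exists>j. (cell x, j) \<in> R}"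
  proof (intro equalityI subsetI)
    fix x assume "x \<in> \<Union>{X closure_of e \<alpha> | \<alpha>. \<exists>j. (\<alpha>, j) \<in> R}"
    then obtain \<alpha> j where "x \<in> X closure_of e \<alpha>" "(\<alpha>, j) \<in> R"
      by blast
    then show "x \<in> {x \<in> topspace X. \<exists>j. (cell x, j) \<in> R}"
      using R down closure_of_cell_order by blast
  next
    fix x assume "x \<in> {x \<in> topspace X. \<exists>j. (cell x, j) \<in> R}"
    then show "x \<in> \<Union>{X closure_of e \<alpha> | \<alpha>. \<exists>j. (\<alpha>, j) \<in> R}"
      using in_closure_of_own_cell by blast
  qed
  then show ?thesis
    by (simp add: rel_domain_complex_def)
qed

text \<open>
  If any piece \<open>closed_cell \<alpha> \<times> |\<tau>|\<close> of the subcomplex contains a point, then the smallest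
  candidate, its own closed cell times the simplex spanned by its support, is also such a piece,
  because \<open>R\<close> is downwardly closed.
\<close>
lemma rel_product_complex_eq:
  assumes R: "R \<subseteq> A \<times> J"
    and down: "\<And>\<alpha> \<beta> j. \<lbrakk>(\<alpha>, j) \<in> R; (\<beta>, \<alpha>) \<in> cell_order X A e\<rbrakk> \<Longrightarrow> (\<beta>, j) \<in> R"
  shows "rel_product_complex X A e J R = subtopology (kification (prod_topology X (realization J)))
    {(x, t). x \<in> topspace X \<and> t \<in> topspace (realization J) \<and> (\<forall>j. t j \<noteq> 0 \<longrightarrow> (cell x, j) \<in> R)}"
proof -
  let ?E = "{(x, t). x \<in> topspace X \<and> t \<in> topspace (realization J) \<and> (\<forall>j. t j \<noteq> 0 \<longrightarrow> (cell x, j) \<in> R)}"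
  let ?U = "\<Union>{(X closure_of e \<alpha>) \<times> geometric_simplex \<tau> | \<alpha> \<tau>. (\<alpha>, \<tau>) \<in> rel_simplices A J R}"
  have "?U = ?E"
  proof (intro equalityI subsetI)
    fix z assume "z \<in> ?U"
    then obtain x t \<alpha> \<tau> where z: "z = (x, t)" "x \<in> X closure_of e \<alpha>" "t \<in> geometric_simplex \<tau>"
      and \<alpha>\<tau>: "\<alpha> \<in> A" "\<tau> \<in> finite_simplices J" "{\<alpha>} \<times> \<tau> \<subseteq> R"
      by (auto simp: rel_simplices_def)
    have "(cell x, j) \<in> R" if "t j \<noteq> 0" for j
    proof -
      have "j \<in> \<tau>"
        using that z(3) by (auto simp: geometric_simplex_def)
      then have "(\<alpha>, j) \<in> R"
        using \<alpha>\<tau>(3) by blast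
      then show ?thesis
        using down closure_of_cell_order[OF \<alpha>\<tau>(1) z(2)] by blast
    qed
    then show "z \<in> ?E"
      using z \<alpha>\<tau> closure_of_cell_order[OF \<alpha>\<tau>(1) z(2)] by (auto simp: topspace_realization)
  next
    fix z assume "z \<in> ?E"
    then obtain x t where z: "z = (x, t)" "x \<in> topspace X" "t \<in> topspace (realization J)"
      and "\<forall>j. t j \<noteq> 0 \<longrightarrow> (cell x, j) \<in> R"
      by auto
    then have "(cell x, {j. t j \<noteq> 0}) \<in> rel_simplices A J R"
      using geometric_simplex_support[OF z(3)] cell_in[OF z(2)] by (auto simp: rel_simplices_def)
    moreover have "z \<in> (X closure_of e (cell x)) \<times> geometric_simplex {j. t j \<noteq> 0}"
      using z in_closure_of_own_cell geometric_simplex_support by simp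
    ultimately show "z \<in> ?U"
      by blast
  qed
  then show ?thesis
    by (simp add: rel_product_complex_def compactly_generated_prod_def)
qed

end

theorem lemma4p2p2:
  fixes X :: "'x topology" and A :: "'a set" and e :: "'a \<Rightarrow> 'x set"
    and J :: "'j set" and R :: "('a \<times> 'j) set"
  assumes "cw_complex X A e"
    and "R \<subseteq> A \<times> J"
    and "\<And>\<alpha> \<alpha>' j. \<lbrakk>\<alpha> \<in> A; \<alpha>' \<in> A; j \<in> J; (\<alpha>, j) \<in> R; (\<alpha>', \<alpha>) \<in> cell_order X A e\<rbrakk>
           \<Longrightarrow> (\<alpha>', j) \<in> R"
  shows "homotopy_equivalence_map (rel_product_complex X A e J R) (rel_domain_complex X e R) fst"
proof -
  obtain d \<Phi> where "cw_structure X A e d \<Phi>"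
    using cw_complex_imp_cw_structure[OF assms(1)] by blast
  then interpret cw_structure X A e d \<Phi> .
  have down: "(\<beta>, j) \<in> R" if "(\<alpha>, j) \<in> R" "(\<beta>, \<alpha>) \<in> cell_order X A e" for \<alpha> \<beta> j
    using assms(2,3) that cell_order_in_A by blast
  let ?I = "top_of_set {0..1::real}"
  let ?W = "kification (prod_topology X (realization J))"
  define D where "D = {x \<in> topspace X. \<exists>j. (cell x, j) \<in> R}"
  define E where "E = {(x, t). x \<in> topspace X \<and> t \<in> topspace (realization J) \<and>
      (\<forall>j. t j \<noteq> 0 \<longrightarrow> (cell x, j) \<in> R)}"
  have E_D: "fst z \<in> D" if "z \<in> E" for z
  proof -
    have "{j. snd z j \<noteq> 0} \<in> finite_simplices J"
      using that by (intro geometric_simplex_support) (auto simp: E_def)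
    then obtain j where "snd z j \<noteq> 0"
      by (auto simp: finite_simplices_def)
    then have "fst z \<in> topspace X" "(cell (fst z), j) \<in> R"
      using that by (auto simp: E_def)
    then show ?thesis
      unfolding D_def by blast
  qed
  have "homotopy_equivalence_map (subtopology ?W E) (subtopology X D) fst"
  proof (cases "J = {}")
    case True
    then have "D = {}"
      using assms(2) by (auto simp: D_def)
    moreover from this have "E = {}"
      using E_D by blast
    ultimately show ?thesis
      by (simp add: homotopy_equivalence_map_trivial)
  next
    case False
    \<comment> \<open>Cells that do not occur in \<open>R\<close> get an arbitrary vertex, so that \<open>weight\<close> is defined and
        continuous on all of \<open>X\<close>; no such cell lies below a cell that occurs in \<open>R\<close>.\<close>
    have "\<exists>j\<in>J. (\<exists>k. (\<alpha>, k) \<in> R) \<longrightarrow> (\<alpha>, j) \<in> R" for \<alpha>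
      using False assms(2) by blast
    then obtain pick where pick: "\<And>\<alpha>. pick \<alpha> \<in> J" "\<And>\<alpha> k. (\<alpha>, k) \<in> R \<Longrightarrow> (\<alpha>, pick \<alpha>) \<in> R"
      by metis
    then have pick_J: "pick ` A \<subseteq> J"
      by blast
    have weight_R: "(cell (push 1 x), j) \<in> R" if "x \<in> D" "weight pick x j \<noteq> 0" for x j
      using weight_support[of x pick j] that pick(2) down unfolding D_def by blast
    define g where "g = (\<lambda>x. (push 1 x, weight pick x))"
    have push_1: "continuous_map X X (push 1)"
    proof -
      have "continuous_map X (prod_topology ?I X) (\<lambda>x. (1, x))"
        by (auto simp: continuous_map_pairwise o_def)
      from continuous_map_compose[OF this continuous_push] show ?thesis
        by (simp add: o_def)
    qed
    have fst_W: "continuous_map ?W X fst" and snd_W: "continuous_map ?W (realization J) snd"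
      by (auto intro: continuous_map_from_kification continuous_map_fst continuous_map_snd)
    \<comment> \<open>Homotopies are constructed on the whole product and then restricted: there, continuity into
        the k-ification amounts to continuity of both components.\<close>
    have k: "k_space (prod_topology ?I ?W)"
      by (intro k_space_prod_topology_left)
        (auto simp: compact_imp_locally_compact_space compact_space_subtopology Hausdorff_space_subtopology)
    have fst_cont: "continuous_map (subtopology ?W E) (subtopology X D) fst"
      using fst_W E_D by (auto simp: continuous_map_in_subtopology continuous_map_from_subtopology)
    have g_cont: "continuous_map (subtopology X D) (subtopology ?W E) g"
    proof -
      have "continuous_map X ?W g"
        using push_1 continuous_weight[OF pick_J]
        by (simp add: continuous_map_into_kification[OF k_space_cw] continuous_map_pairwise g_def o_def)
      moreover have "g x \<in> E" if "x \<in> D" for x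
        using that weight_R weight_in_realization[OF pick_J] push_cell_order[of x 1]
        by (auto simp: g_def E_def D_def)
      ultimately show ?thesis
        by (auto simp: continuous_map_in_subtopology continuous_map_from_subtopology)
    qed
    have "homotopic_with (\<lambda>_. True) (subtopology X D) (subtopology X D) id (fst \<circ> g)"
    proof (rule homotopic_with_subtopologyI[OF continuous_push])
      fix s x assume "s \<in> {0..1::real}" "x \<in> topspace X \<inter> D"
      then show "(case (s, x) of (s, x) \<Rightarrow> push s x) \<in> D"
        using push_cell_order[of x s] down by (auto simp: D_def)
    qed (auto simp: push_0 g_def)
    moreover
    have "homotopic_with (\<lambda>_. True) (subtopology ?W E) (subtopology ?W E) id (\<lambda>z. (push 1 (fst z), snd z))"
    proof (rule homotopic_with_subtopologyI[where h = "\<lambda>(s, z). (push s (fst z), snd z)"])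
      have "continuous_map (prod_topology ?I ?W) (prod_topology ?I X) (\<lambda>(s, z). (s, fst z))"
        using fst_W by (simp add: continuous_map_prod_top)
      from continuous_map_compose[OF this continuous_push]
      have "continuous_map (prod_topology ?I ?W) X (\<lambda>z. push (fst z) (fst (snd z)))"
        by (simp add: o_def case_prod_unfold)
      moreover have "continuous_map (prod_topology ?I ?W) (realization J) (\<lambda>z. snd (snd z))"
        using continuous_map_compose[OF continuous_map_snd snd_W] by (simp add: o_def)
      ultimately show "continuous_map (prod_topology ?I ?W) ?W (\<lambda>(s, z). (push s (fst z), snd z))"
        by (simp add: continuous_map_into_kification[OF k] continuous_map_pairwise o_def case_prod_unfold)
    next
      fix s z assume "s \<in> {0..1::real}" "z \<in> topspace ?W \<inter> E"
      then show "(case (s, z) of (s, z) \<Rightarrow> (push s (fst z), snd z)) \<in> E"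
        using push_cell_order[of "fst z" s] down by (auto simp: E_def)
    qed (auto simp: push_0)
    moreover
    have "homotopic_with (\<lambda>_. True) (subtopology ?W E) (subtopology ?W E)
        (\<lambda>z. (push 1 (fst z), snd z)) (g \<circ> fst)"
    proof (rule homotopic_with_subtopologyI[where
          h = "\<lambda>(s, z). (push 1 (fst z), \<lambda>j. (1 - s) * snd z j + s * weight pick (fst z) j)"])
      have fst2: "continuous_map (prod_topology ?I ?W) X (\<lambda>z. fst (snd z))"
        using continuous_map_compose[OF continuous_map_snd fst_W] by (simp add: o_def)
      have snd2: "continuous_map (prod_topology ?I ?W) (realization J) (\<lambda>z. snd (snd z))"
        using continuous_map_compose[OF continuous_map_snd snd_W] by (simp add: o_def)
      have "continuous_map (prod_topology ?I ?W) X (\<lambda>z. push 1 (fst (snd z)))"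
        using continuous_map_compose[OF fst2 push_1] by (simp add: o_def)
      moreover have w: "continuous_map (prod_topology ?I ?W) (realization J) (\<lambda>z. weight pick (fst (snd z)))"
        using continuous_map_compose[OF fst2 continuous_weight[OF pick_J]] by (simp add: o_def)
      have "continuous_map (prod_topology ?I ?W) (realization J)
          (\<lambda>z j. (1 - fst z) * snd (snd z) j + fst z * weight pick (fst (snd z)) j)"
      proof (rule continuous_map_realization_convex[OF k snd2 w])
        show "continuous_map (prod_topology ?I ?W) euclideanreal fst"
          using continuous_map_fst continuous_map_in_subtopology by blast
      qed auto
      ultimately show "continuous_map (prod_topology ?I ?W) ?W
          (\<lambda>(s, z). (push 1 (fst z), \<lambda>j. (1 - s) * snd z j + s * weight pick (fst z) j))"
        by (simp add: continuous_map_into_kification[OF k] continuous_map_pairwise o_def case_prod_unfold)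
    next
      fix s z assume s: "s \<in> {0..1::real}" and z: "z \<in> topspace ?W \<inter> E"
      obtain x t where xt: "z = (x, t)"
        by (cases z)
      have x: "x \<in> topspace X" "x \<in> D" and t: "t \<in> topspace (realization J)"
        and t_R: "\<And>j. t j \<noteq> 0 \<Longrightarrow> (cell x, j) \<in> R"
        using z E_D[of z] by (auto simp: xt E_def)
      have push: "push 1 x \<in> topspace X" "(cell (push 1 x), cell x) \<in> cell_order X A e"
        using push_cell_order[OF x(1)] by auto
      have "(\<lambda>j. (1 - s) * t j + s * weight pick x j) \<in> topspace (realization J)"
        using s t weight_in_realization[OF pick_J x(1)] by (intro realization_convex) auto
      moreover have "(cell (push 1 x), j) \<in> R" if "(1 - s) * t j + s * weight pick x j \<noteq> 0" for j
      proof (cases "t j = 0")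
        case True
        then show ?thesis
          using that weight_R[OF x(2)] by simp
      next
        case False
        then show ?thesis
          using t_R push(2) down by blast
      qed
      ultimately show "(case (s, z) of (s, z) \<Rightarrow>
          (push 1 (fst z), \<lambda>j. (1 - s) * snd z j + s * weight pick (fst z) j)) \<in> E"
        using push(1) by (simp add: xt E_def)
    qed (auto simp: g_def)
    ultimately show ?thesis
      unfolding homotopy_equivalence_map_def
      using fst_cont g_cont by (meson homotopic_with_symD homotopic_with_trans)
  qed
  then show ?thesis
    using rel_domain_complex_eq[OF assms(2) down] rel_product_complex_eq[OF assms(2) down]
    by (simp add: D_def E_def)
qed

end
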